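(* Let $r\ge 3$ be an integer such that $r-1$ is a prime power. Then: (i) there exists an $[r,2r;3]$-bigraph of order $3r^2-3r+3$, whose defect is $\delta=\frac{3}{2}(r-1)$ if $r$ is odd and $\delta=\frac{3r}{2}-3$ if $r$ is even; (ii) there exists an $[r,2r;4]$-bigraph of order $3r^3-6r^2+6r$, whose defect is $\delta=3r^3-3r^2$; (iii) there exists an $[r,2r;6]$-bigraph of order $3r^5-12r^4+21r^3-18r^2+9r$, whose defect is $\delta=9r^5-24r^4+24r^3-9r^2$.
   Context: An $[a,b;d]$-bigraph is a connected bipartite graph with stable sets $V_1,V_2$, all vertices of $V_1$ of degree $a$, all vertices of $V_2$ of degree $b$, and diameter $d$. For degrees $2r>r$, the Moore bounds are: for odd diameter $3$, $M(2r,r;3)=3\left\lfloor\frac{1+r(2r-1)}{2}\right\rfloor$; for even diameter $2m$, $M(2r,r;2m)=3r\frac{[(2r-1)(r-1)]^m-1}{(2r-1)(r-1)-1}$ (so $M(2r,r;4)=6r^3-9r^2+6r$ and $M(2r,r;6)=12r^5-36r^4+45r^3-27r^2+9r$). The defect of an $[r,2r;d]$-bigraph is $M(2r,r;d)$ minus its order. *)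

theory Defs
  imports
    "Graph_Theory.Graph_Theory"
    "HOL-Number_Theory.Prime_Powers"
begin

text \<open>
  Undirected finite simple graphs are the \<open>graph\<close> locale of Graph\_Theory: finite loopfree
  digraphs without parallel arcs and with symmetric arc relation. Each edge is thus a pair of
  opposite arcs, and the degree of a vertex is its \<open>out_degree\<close>.
\<close>

text \<open>The distance of two vertices is the library's \<open>\<mu>\<close> (infimum of walk costs) with unit arc costs.\<close>

definition graph_dist :: "('a, 'b) pre_digraph \<Rightarrow> 'a \<Rightarrow> 'a \<Rightarrow> ereal" where
  "graph_dist G u v = wf_digraph.\<mu> G (\<lambda>_. 1) u v"

definition graph_diameter :: "('a, 'b) pre_digraph \<Rightarrow> ereal" where
  "graph_diameter G = (SUP u \<in> verts G. SUP v \<in> verts G. graph_dist G u v)"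

definition stable_set :: "('a, 'b) pre_digraph \<Rightarrow> 'a set \<Rightarrow> bool" where
  "stable_set G S \<longleftrightarrow> S \<subseteq> verts G \<and> (\<forall>u \<in> S. \<forall>v \<in> S. (u, v) \<notin> arcs_ends G)"

definition bigraph :: "nat \<Rightarrow> nat \<Rightarrow> nat \<Rightarrow> ('a, 'b) pre_digraph \<Rightarrow> bool" where
  "bigraph a b d G \<longleftrightarrow>
     graph G \<and> Digraph_Component.connected G \<and>
     (\<exists>V\<^sub>1 V\<^sub>2. verts G = V\<^sub>1 \<union> V\<^sub>2 \<and> V\<^sub>1 \<inter> V\<^sub>2 = {} \<and>
        stable_set G V\<^sub>1 \<and> stable_set G V\<^sub>2 \<and>
        (\<forall>v \<in> V\<^sub>1. out_degree G v = a) \<and>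
        (\<forall>v \<in> V\<^sub>2. out_degree G v = b)) \<and>
     graph_diameter G = ereal (real d)"

text \<open>The Moore bound \<open>M(2r, r; d)\<close>, specified only for \<open>d = 3\<close> and for even \<open>d = 2m\<close>.\<close>

definition moore_bound :: "nat \<Rightarrow> nat \<Rightarrow> real" where
  "moore_bound r d =
     (if d = 3 then 3 * real_of_int \<lfloor>(1 + real r * (2 * real r - 1)) / 2\<rfloor>
      else if even d then
        3 * real r * ((((2 * real r - 1) * (real r - 1)) ^ (d div 2) - 1)
          / ((2 * real r - 1) * (real r - 1) - 1))
      else undefined)"

definition defect :: "nat \<Rightarrow> nat \<Rightarrow> ('a, 'b) pre_digraph \<Rightarrow> real" where
  "defect r d G = moore_bound r d - real (card (verts G))"

end

theory Submission
  imports Defs "HOL-Algebra.Algebraic_Closure_Type" "Berlekamp_Zassenhaus.Finite_Field"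
    "HOL-Library.Product_Plus"
begin

text \<open>
  Let \<open>q = r - 1\<close>. For \<open>d = 3, 4, 6\<close> take the generalized \<open>d\<close>-gon of order \<open>(q, q)\<close> given by the
  projective plane, the symplectic quadrangle and the split Cayley hexagon. Its incidence graph is
  \<open>r\<close>-regular of diameter \<open>d\<close> with \<open>1 + q + \<dots> + q\<^bsup>d - 1\<^esup>\<close> points and as many lines. Replacing each
  point by two copies with the same neighbours doubles the degree of the lines and keeps the diameter.
  In the hexagon, points are null trace-zero octonions up to scalars, collinear if their product
  vanishes. A line meets the hyperplane orthogonal to a point \<open>x\<close> in some point \<open>y\<close>, and
  then \<open>x * y\<close>, if not zero, is collinear with both \<open>x\<close> and \<open>y\<close>; so points and lines have distance
  at most five.
\<close>

text \<open>Only degrees, order and diameter have to be established, and the first two are read off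
  from vectors: degrees from the number of vectors related to an isotropic one, the number of points
  from the number of isotropic vectors. Double counting of flags then gives as many lines as points.
  For \<open>d = 4\<close> and \<open>d = 6\<close> the upper bound on distances reduces to
  point-line pairs, and the lower bound needs a single extremal pair. The obstacle is the field:
  vectors live in types, which cannot be chosen for a variable \<open>q\<close>. Hence the vertices
  are renamed to natural numbers, which frees the existence claim of any field type.\<close>

hide_const (open) Divisibility.prime Polynomials.degree Polynomials.lead_coeff UnivPoly.monom UnivPoly.coeff

section \<open>Graphs of symmetric relations\<close>

definition graph_of :: "'v set \<Rightarrow> ('v \<times> 'v) set \<Rightarrow> ('v, 'v \<times> 'v) pre_digraph" where
  "graph_of W E = \<lparr>verts = W, arcs = E, tail = fst, head = snd\<rparr>"

lemma graph_of_simps [simp]: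
  "verts (graph_of W E) = W" "arcs (graph_of W E) = E"
  "tail (graph_of W E) = fst" "head (graph_of W E) = snd"
  by (simp_all add: graph_of_def)

lemma arcs_ends_graph_of [simp]: "arcs_ends (graph_of W E) = E"
  by (auto simp: arcs_ends_def arc_to_ends_def)

lemma graph_graph_of:
  assumes "finite W" "E \<subseteq> W \<times> W" "sym E" "irrefl E"
  shows "graph (graph_of W E)"
proof -
  have "finite E"
    using assms finite_subset by blast
  thus ?thesis
    using assms
    by unfold_locales (auto simp: arc_to_ends_def irrefl_def symmetric_def)
qed

context
  fixes W :: "'v set" and E :: "('v \<times> 'v) set"
  assumes E: "E \<subseteq> W \<times> W"
begin

interpretation wf_digraph "graph_of W E"
  using E by unfold_locales auto

text \<open>Replaces the walks of the digraph library by relation powers, in which all distance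
  arguments are carried out. \<open>u \<in> W\<close> matters at length zero: an empty
  \<open>awalk\<close> must start in a vertex, whereas \<open>E ^^ 0\<close> is the identity on the
  whole type.\<close>

lemma ex_awalk_iff_relpow:
  "u \<in> W \<Longrightarrow> (\<exists>p. pre_digraph.awalk (graph_of W E) u p v \<and> length p = n) \<longleftrightarrow> (u, v) \<in> E ^^ n"
proof (induction n arbitrary: u)
  case 0
  thus ?case by (auto simp: awalk_def)
next
  case (Suc n)
  have "(\<exists>p. awalk u p v \<and> length p = Suc n) \<longleftrightarrow>
      (\<exists>w. (u, w) \<in> E \<and> (\<exists>p. awalk w p v \<and> length p = n))"
  proof safe
    fix p assume p: "awalk u p v" "length p = Suc n"
    then obtain e p' where "p = e # p'"
      by (cases p) auto
    with p have "(u, snd e) \<in> E" "awalk (snd e) p' v" "length p' = n"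
      using E by (auto simp: awalk_def)
    thus "\<exists>w. (u, w) \<in> E \<and> (\<exists>p. awalk w p v \<and> length p = n)"
      by blast
  next
    fix w p assume "(u, w) \<in> E" "awalk w p v" "n = length p"
    with Suc.prems have "awalk u ((u, w) # p) v"
      by (simp add: awalk_def)
    thus "\<exists>p'. awalk u p' v \<and> length p' = Suc (length p)"
      by (metis length_Cons)
  qed
  also have "\<dots> \<longleftrightarrow> (\<exists>w. (u, w) \<in> E \<and> (w, v) \<in> E ^^ n)"
    using E Suc.IH by (metis (no_types, lifting) mem_Sigma_iff subsetD)
  also have "\<dots> \<longleftrightarrow> (u, v) \<in> E ^^ Suc n"
    by (metis relpow_Suc_D2 relpow_Suc_I2)
  finally show ?case .
qed

lemma graph_dist_graph_of:
  "u \<in> W \<Longrightarrow> graph_dist (graph_of W E) u v = (INF n\<in>{n. (u, v) \<in> E ^^ n}. ereal (real n))"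
proof -
  assume u: "u \<in> W"
  have cost: "awalk_cost (\<lambda>_. 1) p = real (length p)" for p
    by (simp add: awalk_cost_def sum_list_triv)
  have "{n. (u, v) \<in> E ^^ n} = length ` {p. awalk u p v}"
    by (auto simp flip: ex_awalk_iff_relpow[OF u])
  thus ?thesis
    by (simp add: graph_dist_def \<mu>_def cost image_image)
qed

lemma graph_diameter_graph_of:
  assumes upper: "\<And>u v. u \<in> W \<Longrightarrow> v \<in> W \<Longrightarrow> \<exists>n\<le>d. (u, v) \<in> E ^^ n"
    and far: "u \<in> W" "v \<in> W" "\<And>n. n < d \<Longrightarrow> (u, v) \<notin> E ^^ n"
  shows "graph_diameter (graph_of W E) = ereal (real d)"
proof (rule antisym)
  show "graph_diameter (graph_of W E) \<le> ereal (real d)"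
    unfolding graph_diameter_def
  proof (intro SUP_least)
    fix u v assume "u \<in> verts (graph_of W E)" "v \<in> verts (graph_of W E)"
    then obtain n where "u \<in> W" "n \<le> d" "(u, v) \<in> E ^^ n"
      using upper by auto
    thus "graph_dist (graph_of W E) u v \<le> ereal (real d)"
      by (auto simp: graph_dist_graph_of intro: INF_lower2)
  qed
  have "ereal (real d) \<le> graph_dist (graph_of W E) u v"
    unfolding graph_dist_graph_of[OF far(1)]
  proof (rule INF_greatest)
    fix n assume "n \<in> {n. (u, v) \<in> E ^^ n}"
    thus "ereal (real d) \<le> ereal (real n)"
      using far(3)[of n] by (cases "n < d") auto
  qed
  also have "\<dots> \<le> (SUP v\<in>W. graph_dist (graph_of W E) u v)"
    using far(2) by (rule SUP_upper)
  also have "\<dots> \<le> graph_diameter (graph_of W E)"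
    unfolding graph_diameter_def using far(1)
    by (auto intro: SUP_upper)
  finally show "ereal (real d) \<le> graph_diameter (graph_of W E)" .
qed

lemma connected_graph_of:
  assumes "W \<noteq> {}" and path: "\<And>u v. u \<in> W \<Longrightarrow> v \<in> W \<Longrightarrow> \<exists>n. (u, v) \<in> E ^^ n"
  shows "Digraph_Component.connected (graph_of W E)"
proof -
  have "u \<rightarrow>\<^sup>*\<^bsub>graph_of W E\<^esub> v" if "u \<in> W" "v \<in> W" for u v
    using path[OF that] ex_awalk_iff_relpow[OF that(1)] by (metis reachable_awalk)
  thus ?thesis
    unfolding Digraph_Component.connected_def using \<open>W \<noteq> {}\<close>
    by (intro strongly_connectedI) (auto intro: reachable_mk_symmetricI)
qed

end

lemma relpow_map_prod_inj:
  assumes "inj f"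
  shows "(f u, w) \<in> (map_prod f f ` E) ^^ n \<longleftrightarrow> (\<exists>v. w = f v \<and> (u, v) \<in> E ^^ n)"
proof (induction n arbitrary: w)
  case (Suc n)
  thus ?case
    using injD[OF assms] by (fastforce simp: relcomp_unfold)
qed auto

text \<open>An injection of the finite vertex type into the naturals gives the graph the type
  demanded by the theorem. It also removes the field type from the conclusion, so that existence can
  be stated for a mere number.\<close>

lemma ex_bigraph_of_relation:
  fixes V\<^sub>1 V\<^sub>2 :: "'v :: finite set"
  assumes E: "E \<subseteq> V\<^sub>1 \<times> V\<^sub>2 \<union> V\<^sub>2 \<times> V\<^sub>1" "sym E" "V\<^sub>1 \<inter> V\<^sub>2 = {}"
    and deg: "\<And>u. u \<in> V\<^sub>1 \<Longrightarrow> card (E `` {u}) = a" "\<And>u. u \<in> V\<^sub>2 \<Longrightarrow> card (E `` {u}) = b"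
    and upper: "\<And>u v. u \<in> V\<^sub>1 \<union> V\<^sub>2 \<Longrightarrow> v \<in> V\<^sub>1 \<union> V\<^sub>2 \<Longrightarrow> \<exists>n\<le>d. (u, v) \<in> E ^^ n"
    and far: "u \<in> V\<^sub>1 \<union> V\<^sub>2" "v \<in> V\<^sub>1 \<union> V\<^sub>2" "\<And>n. n < d \<Longrightarrow> (u, v) \<notin> E ^^ n"
  shows "\<exists>G :: (nat, nat \<times> nat) pre_digraph. bigraph a b d G \<and> card (verts G) = card V\<^sub>1 + card V\<^sub>2"
proof -
  obtain f :: "'v \<Rightarrow> nat" where inj: "inj f"
    using finite_imp_inj_to_nat_seg[OF finite_class.finite_UNIV] by metis
  define W where "W = f ` (V\<^sub>1 \<union> V\<^sub>2)"
  define F where "F = map_prod f f ` E"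
  have F: "F \<subseteq> W \<times> W" "sym F"
    using E by (auto simp: F_def W_def sym_def)
  have bip: "F \<subseteq> f ` V\<^sub>1 \<times> f ` V\<^sub>2 \<union> f ` V\<^sub>2 \<times> f ` V\<^sub>1"
    using E(1) by (auto simp: F_def)
  have disj: "f ` V\<^sub>1 \<inter> f ` V\<^sub>2 = {}"
    using E(3) inj by (auto dest: injD)
  have relpow: "(f u, f v) \<in> F ^^ n \<longleftrightarrow> (u, v) \<in> E ^^ n" for u v n
    using injD[OF inj] by (auto simp: F_def relpow_map_prod_inj[OF inj])
  have upper': "\<exists>n\<le>d. (u, v) \<in> F ^^ n" if "u \<in> W" "v \<in> W" for u v
    using that upper unfolding W_def by (auto simp: relpow)
  have out: "out_degree (graph_of W F) (f u) = card (E `` {u})" for u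
  proof -
    have "out_arcs (graph_of W F) (f u) = (\<lambda>v. (f u, f v)) ` (E `` {u})"
      using injD[OF inj] by (force simp: out_arcs_def F_def)
    moreover have "inj (\<lambda>v. (f u, f v))"
      using inj by (auto simp: inj_def)
    ultimately show ?thesis
      by (simp add: out_degree_def card_image inj_on_subset)
  qed
  have "bigraph a b d (graph_of W F)"
    unfolding bigraph_def
  proof (intro conjI exI)
    show "graph (graph_of W F)"
      using F bip disj by (intro graph_graph_of) (auto simp: W_def irrefl_def)
    show "Digraph_Component.connected (graph_of W F)"
      using F(1)
    proof (rule connected_graph_of)
      show "W \<noteq> {}"
        using far(1) by (auto simp: W_def)
    qed (use upper' in blast)
    show "graph_diameter (graph_of W F) = ereal (real d)"
      using F(1) upper'
      by (rule graph_diameter_graph_of[where u = "f u" and v = "f v"])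
        (use far in \<open>auto simp: W_def relpow\<close>)
    show "verts (graph_of W F) = f ` V\<^sub>1 \<union> f ` V\<^sub>2"
      by (auto simp: W_def)
    show "stable_set (graph_of W F) (f ` V\<^sub>1)" "stable_set (graph_of W F) (f ` V\<^sub>2)"
      using bip disj by (auto simp: stable_set_def W_def)
  qed (use disj deg in \<open>auto simp: out\<close>)
  moreover have "card W = card V\<^sub>1 + card V\<^sub>2"
    using E(3) inj by (simp add: W_def card_image inj_on_subset card_Un_disjoint)
  ultimately show ?thesis
    by (metis graph_of_simps(1))
qed

section \<open>Incidence structures with doubled points\<close>

definition incidence_graph :: "('p \<times> 'l) set \<Rightarrow> ('p + 'l) rel" where
  "incidence_graph I = {(u, v). \<exists>(p, l)\<in>I. (u, v) = (Inl p, Inr l) \<or> (u, v) = (Inr l, Inl p)}"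

lemma incidence_graph_simps [simp]:
  "(Inl p, Inr l) \<in> incidence_graph I \<longleftrightarrow> (p, l) \<in> I"
  "(Inr l, Inl p) \<in> incidence_graph I \<longleftrightarrow> (p, l) \<in> I"
  "(Inl p, Inl p') \<notin> incidence_graph I" "(Inr l, Inr l') \<notin> incidence_graph I"
  by (auto simp: incidence_graph_def)

lemma sym_incidence_graph: "sym (incidence_graph I)"
  by (auto simp: incidence_graph_def sym_def)

text \<open>Steps alternate between points and lines; this rules out every second length when
  distances are bounded from below.\<close>

lemma incidence_graph_parity:
  "(u, v) \<in> incidence_graph I ^^ n \<Longrightarrow> isl u = isl v \<longleftrightarrow> even n"
proof (induction n arbitrary: v)
  case (Suc n)
  then obtain w where "(u, w) \<in> incidence_graph I ^^ n" "(w, v) \<in> incidence_graph I"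
    by auto
  thus ?case
    using Suc.IH[of w] by (cases w; cases v) auto
qed simp

lemma sym_relpow:
  assumes "sym E"
  shows "(u, v) \<in> E ^^ n \<Longrightarrow> (v, u) \<in> E ^^ n"
proof (induction n arbitrary: v)
  case (Suc n)
  then obtain w where "(u, w) \<in> E ^^ n" "(w, v) \<in> E"
    by auto
  hence "(v, w) \<in> E" "(w, u) \<in> E ^^ n"
    using Suc.IH symD[OF assms] by blast+
  thus ?case
    by (rule relpow_Suc_I2)
qed simp

text \<open>Surjectivity lifts the intermediate vertices of a walk. The exponent is positive because
  \<open>inv_image (E ^^ 0) f\<close> relates any two elements with the same image, not only equal
  ones.\<close>

lemma relpow_Suc_inv_image:
  assumes "surj f"
  shows "inv_image E f ^^ Suc n = inv_image (E ^^ Suc n) f"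
proof (induction n)
  case (Suc n)
  have "inv_image E f ^^ Suc (Suc n) = inv_image (E ^^ Suc n) f O inv_image E f"
    by (simp only: relpow.simps(2)[of "Suc n"] Suc.IH)
  also have "\<dots> = inv_image (E ^^ Suc n O E) f"
    using assms by (auto simp: inv_image_def relcomp_unfold simp del: relpow.simps) (metis surjD)
  finally show ?case
    by simp
qed simp

text \<open>Forgetting which copy a point is preserves walks of positive length in both directions.
  What remains are the two copies of one point, whose images coincide: a line through it, which
  exists by \<open>r > 0\<close>, joins them in two steps, hence \<open>d \<ge> 2\<close>.\<close>

lemma ex_bigraph_doubled_points:
  fixes P :: "'p :: finite set" and L :: "'l :: finite set"
  assumes I: "I \<subseteq> P \<times> L"
    and deg: "\<And>p. p \<in> P \<Longrightarrow> card (I `` {p}) = r" "\<And>l. l \<in> L \<Longrightarrow> card (I\<inverse> `` {l}) = r"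
    and pos: "r > 0" and d: "d \<ge> 2"
    and upper: "\<And>u v. u \<in> P <+> L \<Longrightarrow> v \<in> P <+> L \<Longrightarrow> \<exists>n\<le>d. (u, v) \<in> incidence_graph I ^^ n"
    and far: "u \<in> P <+> L" "v \<in> P <+> L" "\<And>n. n < d \<Longrightarrow> (u, v) \<notin> incidence_graph I ^^ n"
  shows "\<exists>G :: (nat, nat \<times> nat) pre_digraph.
    bigraph r (2 * r) d G \<and> card (verts G) = 2 * card P + card L"
proof -
  define f :: "'p \<times> bool + 'l \<Rightarrow> 'p + 'l" where "f = map_sum fst id"
  define E where "E = inv_image (incidence_graph I) f"
  define A where "A = (Inl ` (P \<times> UNIV) :: ('p \<times> bool + 'l) set)"
  define B where "B = (Inr ` L :: ('p \<times> bool + 'l) set)"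
  have surj: "surj f"
    by (intro surjI[of _ "map_sum (\<lambda>p. (p, True)) id"]) (auto simp: f_def sum.map_comp o_def sum.map_ident)
  have f_simps [simp]: "f (Inl pc) = Inl (fst pc)" "f (Inr l) = Inr l" for pc l
    by (simp_all add: f_def)
  have AB: "u \<in> A \<union> B \<longleftrightarrow> f u \<in> P <+> L" for u
    by (cases u) (auto simp: A_def B_def)
  obtain u' v' where f_uv: "f u' = u" "f v' = v"
    using surj by (metis surjD)
  have "\<exists>G :: (nat, nat \<times> nat) pre_digraph. bigraph r (2 * r) d G \<and> card (verts G) = card A + card B"
  proof (rule ex_bigraph_of_relation)
    show "E \<subseteq> A \<times> B \<union> B \<times> A"
      using I by (fastforce simp: E_def A_def B_def incidence_graph_def f_def map_sum_def split: sum.splits)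
    show "sym E"
      using sym_incidence_graph[of I] by (auto simp: E_def sym_def)
    show "A \<inter> B = {}"
      by (auto simp: A_def B_def)
    show "card (E `` {u}) = r" if u_A: "u \<in> A" for u
    proof -
      obtain p c where u: "u = Inl (p, c)" "p \<in> P"
        using u_A by (auto simp: A_def)
      have "x \<in> E `` {u} \<longleftrightarrow> x \<in> Inr ` (I `` {p})" for x
        by (cases x) (auto simp: E_def u)
      hence "E `` {u} = Inr ` (I `` {p})"
        by blast
      thus ?thesis
        using deg(1)[OF u(2)] by (simp add: card_image)
    qed
    show "card (E `` {u}) = 2 * r" if u_B: "u \<in> B" for u
    proof -
      obtain l where u: "u = Inr l" "l \<in> L"
        using u_B by (auto simp: B_def)
      have "x \<in> E `` {u} \<longleftrightarrow> x \<in> Inl ` (I\<inverse> `` {l} \<times> UNIV)" for x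
        by (cases x) (auto simp: E_def u)
      hence "E `` {u} = Inl ` (I\<inverse> `` {l} \<times> UNIV)"
        by blast
      thus ?thesis
        using deg(2)[OF u(2)] by (simp add: card_image card_cartesian_product)
    qed
    show "\<exists>n\<le>d. (u, v) \<in> E ^^ n" if uv: "u \<in> A \<union> B" "v \<in> A \<union> B" for u v
    proof -
      obtain n where n: "n \<le> d" "(f u, f v) \<in> incidence_graph I ^^ n"
        using upper uv by (metis AB)
      show ?thesis
      proof (cases n)
        case (Suc m)
        thus ?thesis
          using n relpow_Suc_inv_image[OF surj, where E = "incidence_graph I" and n = m]
          by (intro exI[of _ n]) (simp add: E_def del: relpow.simps)
      next
        case 0
        hence eq: "f u = f v"
          using n by simp
        show ?thesis
        proof (cases u)
          case (Inl pc)
          hence "fst pc \<in> P"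
            using uv(1) by (auto simp: A_def B_def)
          then obtain l where "(fst pc, l) \<in> I"
            using deg(1)[of "fst pc"] pos by (metis Image_singleton_iff card.empty ex_in_conv less_irrefl)
          hence "(u, Inr l) \<in> E" "(Inr l, v) \<in> E"
            using Inl eq by (cases v; simp add: E_def)+
          hence "(u, v) \<in> E ^^ 2"
            by (auto simp: numeral_2_eq_2)
          thus ?thesis
            using d by blast
        next
          case (Inr l)
          hence "u = v"
            using eq by (cases v) auto
          thus ?thesis
            by (intro exI[of _ 0]) simp
        qed
      qed
    qed
    show "u' \<in> A \<union> B" "v' \<in> A \<union> B"
      using far f_uv by (simp_all only: AB)
    show "(u', v') \<notin> E ^^ n" if "n < d" for n
      using far(3)[OF that] relpow_Suc_inv_image[OF surj, where E = "incidence_graph I"] f_uv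
      by (cases n) (auto simp: E_def simp del: relpow.simps(2))
  qed
  moreover have "card A = 2 * card P" "card B = card L"
    by (simp_all add: A_def B_def card_image card_cartesian_product)
  ultimately show ?thesis
    by simp
qed

section \<open>Geometries of isotropic subspaces\<close>

lemma card_eq_card_image_mult:
  assumes "finite S" "\<And>y. y \<in> S \<Longrightarrow> card {x \<in> S. g x = g y} = k"
  shows "card S = card (g ` S) * k"
proof -
  have "card S = (\<Sum>y\<in>g ` S. card {x \<in> S. g x = y})"
    using sum.image_gen[OF assms(1), of "\<lambda>_. 1 :: nat" g] by simp
  also have "\<dots> = (\<Sum>y\<in>g ` S. k)"
    using assms(2) by (intro sum.cong) auto
  finally show ?thesis
    by simp
qed

lemma CARD_field_gt_1: "CARD('a :: {field, finite}) > 1"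
proof -
  have "card {0, 1 :: 'a} \<le> CARD('a)"
    by (intro card_mono) auto
  thus ?thesis
    by simp
qed

text \<open>The second hypothesis has the shape of \<open>card_points\<close>: the
  \<open>q ^ k\<close> isotropic vectors are zero and \<open>q - 1\<close> nonzero ones for each of
  \<open>N\<close> points. Passing to integers avoids truncated subtraction.\<close>

lemma eq_geometric_sum:
  fixes N q :: nat
  assumes "q > 1" "q ^ k = N * (q - 1) + 1"
  shows "N = (\<Sum>i<k. q ^ i)"
proof -
  have "int N * (int q - 1) = int q ^ k - 1"
    using assms by (simp add: of_nat_diff flip: of_nat_power)
  also have "\<dots> = (\<Sum>i<k. int q ^ i) * (int q - 1)"
    by (simp add: power_diff_1_eq)
  finally have "int N = int (\<Sum>i<k. q ^ i)"
    using assms(1) by simp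
  thus ?thesis
    by (simp only: of_nat_eq_iff)
qed

text \<open>A nonzero functional is onto, and its fibres are translates of its kernel. The laws of
  \<open>scale\<close> are explicit hypotheses because the lemma is applied inside
  \<open>isotropic_geometry_symplectic\<close>, where the vector space is still being
  established.\<close>

lemma card_kernel:
  fixes scale :: "'a :: {field, finite} \<Rightarrow> 'v :: {ab_group_add, finite} \<Rightarrow> 'v"
  assumes lin: "\<And>a b x y. f (scale a x + scale b y) = a * f x + b * f y"
    and one: "\<And>x. scale 1 x = x" and "f x \<noteq> (0 :: 'a)"
  shows "CARD('v) = CARD('a) * card {x. f x = 0}"
proof -
  have add: "f (x + y) = f x + f y" for x y
    using lin[of 1 x 1 y] by (simp add: one)
  have diff: "f (x - y) = f x - f y" for x y
    using add[of "x - y" y] by (metis add_diff_cancel_right' diff_add_cancel)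
  have "card {y. f y = f z} = card {y. f y = 0}" for z
  proof (rule bij_betw_same_card)
    show "bij_betw (\<lambda>y. y - z) {y. f y = f z} {y. f y = 0}"
      by (rule bij_betw_byWitness[where f' = "\<lambda>y. y + z"]) (auto simp: add diff)
  qed
  hence "CARD('v) = card (range f) * card {y. f y = 0}"
    by (intro card_eq_card_image_mult) auto
  moreover have "range f = UNIV"
  proof (intro surjI)
    fix c
    \<comment> \<open>The summand \<open>scale 0 x\<close> brings the argument into the shape
      required by \<open>lin\<close>.\<close>
    have "f (scale (c / f x) x + scale 0 x) = c"
      unfolding lin using \<open>f x \<noteq> 0\<close> by simp
    thus "f ((\<lambda>c. scale (c / f x) x + scale 0 x) c) = c" .
  qed
  ultimately show ?thesis
    by simp
qed

text \<open>That a form vanishes on exactly one \<open>q\<close>-th of its arguments survives the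
  addition of a hyperbolic plane \<open>v * w\<close>: a nonzero \<open>v\<close> determines
  \<open>w\<close> from \<open>z\<close>, while \<open>v = 0\<close> leaves \<open>w\<close> free
  and forces \<open>f z = 0\<close>. The statement can thus be iterated.\<close>

lemma card_hyperbolic_sum_zeros:
  fixes f :: "'z :: finite \<Rightarrow> 'a :: {field, finite}"
  assumes "CARD('a) * card {z. f z = 0} = CARD('z)"
  shows "CARD('a) * card {(v, w, z). v * w + f z = 0} = CARD('a \<times> 'a \<times> 'z)"
proof -
  define A where "A = (\<lambda>(v, z). (v, - f z / v, z)) ` ((UNIV - {0}) \<times> UNIV)"
  define B where "B = {0 :: 'a} \<times> (UNIV :: 'a set) \<times> {z. f z = 0}"
  have "{(v, w, z). v * w + f z = 0} = A \<union> B"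
  proof (intro equalityI subsetI)
    fix u assume "u \<in> {(v, w, z). v * w + f z = 0}"
    then obtain v w z where u: "u = (v, w, z)" "v * w + f z = 0"
      by auto
    show "u \<in> A \<union> B"
    proof (cases "v = 0")
      case False
      have "w * v = - f z"
        using u(2) by (simp add: eq_neg_iff_add_eq_0 mult.commute)
      hence "w = - f z / v"
        using False nonzero_eq_divide_eq by blast
      thus ?thesis
        using False by (auto simp: u A_def)
    qed (use u in \<open>auto simp: B_def\<close>)
  qed (auto simp: A_def B_def split: if_split_asm)
  moreover have "A \<inter> B = {}"
    by (auto simp: A_def B_def)
  moreover have "card A = (CARD('a) - 1) * CARD('z)"
    unfolding A_def by (subst card_image) (auto simp: inj_on_def card_cartesian_product card_Diff_subset)
  moreover have "card B = CARD('z)"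
    using assms by (simp add: B_def card_cartesian_product)
  ultimately have "card {(v, w, z). v * w + f z = 0} = (CARD('a) - 1) * CARD('z) + CARD('z)"
    by (simp add: card_Un_disjoint)
  also have "\<dots> = CARD('a) * CARD('z)"
    using CARD_field_gt_1[where ?'a = 'a] by (simp add: mult_eq_if[of "CARD('a)"])
  finally show ?thesis
    by simp
qed

text \<open>
  The points and lines are the subspaces of dimension one and two on which \<open>R\<close> holds identically.
  In all three instances the vectors related to a given isotropic vector form a three-dimensional
  space, so every point lies on \<open>(q\<^sup>3 - q) / (q\<^sup>2 - q) = q + 1\<close> lines.
\<close>

locale isotropic_geometry = vector_space scale
  for scale :: "'a :: {field, finite} \<Rightarrow> 'v :: {ab_group_add, finite} \<Rightarrow> 'v" (infixr "*s" 75) +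
  fixes R :: "'v \<Rightarrow> 'v \<Rightarrow> bool"
  assumes R_sym: "R x y \<Longrightarrow> R y x"
    and R_zero: "R x 0"
    and R_lin: "R x y \<Longrightarrow> R x z \<Longrightarrow> R x (a *s y + b *s z)"
    and R_null: "R x x \<Longrightarrow> x \<noteq> 0 \<Longrightarrow> R x y \<Longrightarrow> R y y"
    and card_R: "R x x \<Longrightarrow> x \<noteq> 0 \<Longrightarrow> card {y. R x y} = CARD('a) ^ 3"
begin

section \<open>Points, lines and their numbers\<close>

definition pt :: "'v \<Rightarrow> 'v set" where
  "pt x = range (\<lambda>a. a *s x)"

definition join :: "'v \<Rightarrow> 'v \<Rightarrow> 'v set" where
  "join x y = range (\<lambda>(a, b). a *s x + b *s y)"

definition points :: "'v set set" where
  "points = pt ` {x. x \<noteq> 0 \<and> R x x}"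

definition lines :: "'v set set" where
  "lines = {join x y |x y. x \<noteq> 0 \<and> R x x \<and> R x y \<and> y \<notin> pt x}"

definition inc :: "('v set \<times> 'v set) set" where
  "inc = {(p, l). p \<in> points \<and> l \<in> lines \<and> p \<subseteq> l}"

lemma pt_self: "x \<in> pt x"
  unfolding pt_def by (metis rangeI scale_one)

lemma zero_in_pt: "0 \<in> pt x"
  unfolding pt_def by (metis rangeI scale_zero_left)

lemma card_pt: "x \<noteq> 0 \<Longrightarrow> card (pt x) = CARD('a)"
  unfolding pt_def by (intro card_image) (auto simp: inj_on_def)

lemma pt_eqI: "y \<in> pt x \<Longrightarrow> y \<noteq> 0 \<Longrightarrow> pt y = pt x"
proof (rule card_subset_eq)
  assume y: "y \<in> pt x" "y \<noteq> 0"
  show "pt y \<subseteq> pt x"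
    using y(1) by (auto simp: pt_def)
  have "x \<noteq> 0"
    using y by (auto simp: pt_def)
  thus "card (pt y) = card (pt x)"
    using y(2) by (simp add: card_pt)
qed simp

lemma joinE:
  assumes "u \<in> join x y"
  obtains a b where "u = a *s x + b *s y"
  using assms by (auto simp: join_def)

lemma joinI: "a *s x + b *s y \<in> join x y"
  by (auto simp: join_def)

lemma join_gens: "x \<in> join x y" "y \<in> join x y"
  using joinI[of 1 x 0 y] joinI[of 0 x 1 y] by simp_all

lemma join_closed:
  assumes "u \<in> join x y" "v \<in> join x y"
  shows "a *s u + b *s v \<in> join x y"
proof -
  obtain c d c' d' where "u = c *s x + d *s y" "v = c' *s x + d' *s y"
    using assms by (elim joinE)
  hence "a *s u + b *s v = (a * c + b * c') *s x + (a * d + b * d') *s y"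
    by (simp add: scale_right_distrib scale_left_distrib)
  thus ?thesis
    by (metis joinI)
qed

lemma pt_subset_join: "u \<in> join x y \<Longrightarrow> pt u \<subseteq> join x y"
  using join_closed[of u x y u _ 0] by (auto simp: pt_def)

lemma card_join:
  assumes "x \<noteq> 0" "y \<notin> pt x"
  shows "card (join x y) = CARD('a) ^ 2"
proof -
  have "inj (\<lambda>(a, b). a *s x + b *s y)"
  proof (rule injI, clarify)
    fix a b a' b' assume eq: "a *s x + b *s y = a' *s x + b' *s y"
    hence diff: "(b - b') *s y = (a' - a) *s x"
      by (simp add: algebra_simps scale_left_diff_distrib)
    have "b = b'"
    proof (rule ccontr)
      assume "b \<noteq> b'"
      hence "y = inverse (b - b') *s (b - b') *s y"
        by simp
      also have "\<dots> = (inverse (b - b') * (a' - a)) *s x"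
        by (simp only: diff scale_scale)
      finally show False
        using assms(2) by (auto simp: pt_def)
    qed
    with diff assms(1) show "a = a' \<and> b = b'"
      by simp
  qed
  thus ?thesis
    by (simp add: join_def card_image power2_eq_square)
qed

text \<open>Both sets have \<open>q ^ 2\<close> elements, so containment suffices and no
  coefficients have to be inverted.\<close>

lemma join_eqI:
  assumes "x \<noteq> 0" "y \<notin> pt x" "u \<in> join x y" "v \<in> join x y" "u \<noteq> 0" "v \<notin> pt u"
  shows "join u v = join x y"
proof (rule card_subset_eq)
  show "join u v \<subseteq> join x y"
    using join_closed[OF assms(3,4)] by (blast elim: joinE)
qed (use assms in \<open>simp_all add: card_join\<close>)

lemma lineE:
  assumes "l \<in> lines"
  obtains x y where "l = join x y" "x \<noteq> 0" "R x x" "R x y" "y \<notin> pt x"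
  using assms by (auto simp: lines_def)

lemma card_line: "l \<in> lines \<Longrightarrow> card l = CARD('a) ^ 2"
  by (auto elim!: lineE simp: card_join)

text \<open>Linearity in each argument reduces the claim to the generators \<open>x\<close> and
  \<open>y\<close>. There \<open>R_null\<close> supplies \<open>R y y\<close>, which symmetry and
  linearity alone do not give.\<close>

lemma R_line:
  assumes "l \<in> lines" "u \<in> l" "v \<in> l"
  shows "R u v"
proof -
  obtain x y where l: "l = join x y" "x \<noteq> 0" "R x x" "R x y"
    using assms(1) by (elim lineE)
  have "R y y" "R y x"
    using l R_null R_sym by blast+
  have "R x v" "R y v"
    using assms(3) l \<open>R y y\<close> \<open>R y x\<close> R_lin by (auto elim!: joinE)
  hence "R v u"
    using assms(2) l R_lin R_sym by (auto elim!: joinE)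
  thus ?thesis
    by (rule R_sym)
qed

lemma line_closed: "l \<in> lines \<Longrightarrow> u \<in> l \<Longrightarrow> v \<in> l \<Longrightarrow> a *s u + b *s v \<in> l"
  by (auto elim!: lineE intro: join_closed)

lemma pt_subset_line: "l \<in> lines \<Longrightarrow> u \<in> l \<Longrightarrow> pt u \<subseteq> l"
  by (auto elim!: lineE dest: pt_subset_join)

lemma line_eq_join:
  assumes "l \<in> lines" "u \<in> l" "v \<in> l" "u \<noteq> 0" "v \<notin> pt u"
  shows "l = join u v"
  using lineE[OF assms(1)] join_eqI assms(2-5) by metis

lemma pt_in_points: "x \<noteq> 0 \<Longrightarrow> R x x \<Longrightarrow> pt x \<in> points"
  by (auto simp: points_def)

lemma join_in_lines: "x \<noteq> 0 \<Longrightarrow> R x x \<Longrightarrow> R x y \<Longrightarrow> y \<notin> pt x \<Longrightarrow> join x y \<in> lines"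
  by (auto simp: lines_def)

lemma inc_pt_iff:
  "(pt x, l) \<in> inc \<longleftrightarrow> l \<in> lines \<and> x \<in> l" if "x \<noteq> 0"
proof
  show "(pt x, l) \<in> inc" if "l \<in> lines \<and> x \<in> l"
    using that \<open>x \<noteq> 0\<close> R_line pt_subset_line by (auto simp: inc_def intro: pt_in_points)
qed (use pt_self in \<open>auto simp: inc_def\<close>)

lemma card_pt_image:
  assumes "\<And>x a. x \<in> S \<Longrightarrow> a *s x \<in> S"
  shows "card (S - {0}) = card (pt ` (S - {0})) * (CARD('a) - 1)"
proof (rule card_eq_card_image_mult)
  fix y assume y: "y \<in> S - {0}"
  have "{x \<in> S - {0}. pt x = pt y} = pt y - {0}"
  proof (intro equalityI subsetI)
    fix x assume "x \<in> {x \<in> S - {0}. pt x = pt y}"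
    thus "x \<in> pt y - {0}"
      using pt_self[of x] by auto
  next
    fix x assume x: "x \<in> pt y - {0}"
    hence "x \<in> S"
      using assms y by (auto simp: pt_def)
    thus "x \<in> {x \<in> S - {0}. pt x = pt y}"
      using x pt_eqI by auto
  qed
  thus "card {x \<in> S - {0}. pt x = pt y} = CARD('a) - 1"
    using y by (simp add: card_pt zero_in_pt)
qed simp

lemma card_points: "card {x. R x x} = card points * (CARD('a) - 1) + 1"
proof -
  have "R (a *s x) (a *s x)" if "R x x" for a x
    using R_lin[OF that that, of a 0] R_lin[of "a *s x" x x a 0] R_sym that by simp
  hence "card ({x. R x x} - {0}) = card (pt ` ({x. R x x} - {0})) * (CARD('a) - 1)"
    by (intro card_pt_image) auto
  moreover have "{x. R x x} - {0} = {x. x \<noteq> 0 \<and> R x x}"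
    by auto
  moreover have "card {x. R x x} = card ({x. R x x} - {0}) + 1"
    using card_Suc_Diff1[of "{x. R x x}" 0] R_zero by simp
  ultimately show ?thesis
    by (simp add: points_def)
qed

lemma card_points_on_line:
  assumes "l \<in> lines"
  shows "card (inc\<inverse> `` {l}) = CARD('a) + 1"
proof -
  have "inc\<inverse> `` {l} = pt ` (l - {0})"
  proof (intro equalityI subsetI)
    fix p assume "p \<in> inc\<inverse> `` {l}"
    then obtain x where "p = pt x" "x \<noteq> 0" "(pt x, l) \<in> inc"
      by (auto simp: inc_def points_def)
    thus "p \<in> pt ` (l - {0})"
      by (auto simp: inc_pt_iff)
  next
    fix p assume "p \<in> pt ` (l - {0})"
    then obtain x where "p = pt x" "x \<in> l" "x \<noteq> 0"
      by auto
    thus "p \<in> inc\<inverse> `` {l}"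
      using assms by (simp add: inc_pt_iff)
  qed
  moreover have "card (l - {0}) = card (pt ` (l - {0})) * (CARD('a) - 1)"
    using line_closed[OF assms, of _ _ _ 0] by (intro card_pt_image) auto
  moreover have "0 \<in> l"
    using assms line_closed[OF assms, of _ _ 0 0] join_gens(1) by (auto elim!: lineE)
  hence "card (l - {0}) = (CARD('a) + 1) * (CARD('a) - 1)"
    by (simp add: card_line[OF assms] power2_eq_square algebra_simps)
  moreover have "CARD('a) - 1 \<noteq> 0"
    using CARD_field_gt_1[where ?'a = 'a] by simp
  ultimately show ?thesis
    by (metis mult_cancel2)
qed

lemma card_lines_on_point:
  assumes "p \<in> points"
  shows "card (inc `` {p}) = CARD('a) + 1"
proof -
  obtain x where x: "p = pt x" "x \<noteq> 0" "R x x"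
    using assms by (auto simp: points_def)
  define S where "S = {y. R x y} - pt x"
  have "inc `` {p} = join x ` S"
  proof (intro equalityI subsetI)
    fix l assume "l \<in> inc `` {p}"
    hence l: "l \<in> lines" "x \<in> l"
      by (simp_all add: x inc_pt_iff)
    have "\<not> l \<subseteq> pt x"
    proof
      assume "l \<subseteq> pt x"
      hence "card l \<le> card (pt x)"
        by (intro card_mono) auto
      thus False
        using CARD_field_gt_1[where ?'a = 'a] x l by (simp add: card_line card_pt power2_eq_square)
    qed
    then obtain y where "y \<in> l" "y \<notin> pt x"
      by auto
    thus "l \<in> join x ` S"
      using l x line_eq_join[of l x y] R_line[of l x y] by (auto simp: S_def)
  next
    fix l assume "l \<in> join x ` S"
    thus "l \<in> inc `` {p}"
      using x join_gens by (auto simp: S_def inc_pt_iff intro: join_in_lines)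
  qed
  moreover have "card S = card (join x ` S) * (CARD('a) ^ 2 - CARD('a))"
  proof (rule card_eq_card_image_mult)
    fix y assume "y \<in> S"
    hence y: "R x y" "y \<notin> pt x"
      by (auto simp: S_def)
    hence line: "join x y \<in> lines"
      using x join_in_lines by blast
    have "{z \<in> S. join x z = join x y} = join x y - pt x"
    proof (intro equalityI subsetI)
      fix z assume "z \<in> {z \<in> S. join x z = join x y}"
      thus "z \<in> join x y - pt x"
        using join_gens(2)[of z x] by (auto simp: S_def)
    next
      fix z assume "z \<in> join x y - pt x"
      thus "z \<in> {z \<in> S. join x z = join x y}"
        using line_eq_join[OF line join_gens(1), of z] R_line[OF line join_gens(1), of z] x(2)
        by (auto simp: S_def)
    qed
    moreover have "pt x \<subseteq> join x y"
      using pt_subset_join join_gens(1) by blast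
    ultimately show "card {z \<in> S. join x z = join x y} = CARD('a) ^ 2 - CARD('a)"
      using x y by (simp add: card_Diff_subset card_join card_pt)
  qed (simp add: S_def)
  moreover have "pt x \<subseteq> {y. R x y}"
    using x R_lin[of x x x _ 0] by (auto simp: pt_def)
  hence "card S = CARD('a) ^ 3 - CARD('a)"
    unfolding S_def using x by (simp add: card_Diff_subset card_R card_pt)
  moreover have "CARD('a) ^ 3 - CARD('a) = (CARD('a) + 1) * (CARD('a) ^ 2 - CARD('a))"
    by (simp add: power2_eq_square power3_eq_cube algebra_simps)
  moreover have "CARD('a) ^ 2 - CARD('a) > 0"
    using CARD_field_gt_1[where ?'a = 'a] by (simp add: power2_eq_square)
  ultimately show ?thesis
    by (metis mult_cancel2 less_irrefl)
qed

text \<open>Flags are counted once by points and once by lines; both kinds of fibre have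
  \<open>q + 1\<close> elements.\<close>

lemma card_lines: "card lines = card points"
proof -
  have "card inc = card points * (CARD('a) + 1)"
  proof -
    have "inc = Sigma points (\<lambda>p. inc `` {p})"
      by (auto simp: inc_def)
    hence "card inc = (\<Sum>p\<in>points. card (inc `` {p}))"
      by (metis card_SigmaI finite)
    thus ?thesis
      by (simp add: card_lines_on_point)
  qed
  moreover have "card inc = card lines * (CARD('a) + 1)"
  proof -
    have "inc\<inverse> = Sigma lines (\<lambda>l. inc\<inverse> `` {l})"
      by (auto simp: inc_def)
    hence "card (inc\<inverse>) = (\<Sum>l\<in>lines. card (inc\<inverse> `` {l}))"
      by (metis card_SigmaI finite)
    thus ?thesis
      by (simp add: card_points_on_line)
  qed
  ultimately show ?thesis
    by (metis add_gr_0 less_one mult_cancel2 neq0_conv)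
qed

section \<open>Upper bounds for distances in the incidence graph\<close>

definition near :: "nat \<Rightarrow> 'v set + 'v set \<Rightarrow> 'v set + 'v set \<Rightarrow> bool" where
  "near n u v \<longleftrightarrow> (\<exists>k\<le>n. (u, v) \<in> incidence_graph inc ^^ k)"

lemma near_trans: "near m u v \<Longrightarrow> near n v w \<Longrightarrow> near (m + n) u w"
proof -
  assume "near m u v" "near n v w"
  then obtain k k' where "k \<le> m" "k' \<le> n" "(u, w) \<in> incidence_graph inc ^^ (k + k')"
    unfolding near_def relpow_add by blast
  thus ?thesis
    unfolding near_def by (intro exI[of _ "k + k'"]) simp
qed

lemma near_mono: "near m u v \<Longrightarrow> m \<le> n \<Longrightarrow> near n u v"
  unfolding near_def by (auto intro: order_trans)

lemma near_sym: "near n u v \<Longrightarrow> near n v u"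
  unfolding near_def using sym_relpow[OF sym_incidence_graph] by blast

lemma near_edge: "(p, l) \<in> inc \<Longrightarrow> near 1 (Inl p) (Inr l)"
  unfolding near_def by (intro exI[of _ 1]) simp

lemma near_line: "l \<in> lines \<Longrightarrow> x \<in> l \<Longrightarrow> x \<noteq> 0 \<Longrightarrow> near 1 (Inl (pt x)) (Inr l)"
  by (intro near_edge) (simp add: inc_pt_iff)

lemma near_points:
  assumes "x \<noteq> 0" "R x x" "y \<noteq> 0" "R x y"
  shows "near 2 (Inl (pt x)) (Inl (pt y))"
proof (cases "y \<in> pt x")
  case True
  hence "pt y = pt x"
    using assms pt_eqI by blast
  thus ?thesis
    unfolding near_def by (intro exI[of _ 0]) simp
next
  case False
  hence line: "join x y \<in> lines"
    using assms join_in_lines by blast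
  have "near 1 (Inl (pt x)) (Inr (join x y))" "near 1 (Inl (pt y)) (Inr (join x y))"
    using near_line[OF line join_gens(1)] near_line[OF line join_gens(2)] assms by blast+
  from near_trans[OF this(1) near_sym[OF this(2)]] show ?thesis
    by (simp add: numeral_2_eq_2)
qed

text \<open>One step leads from a point or a line to an element of the other kind, so a point-line
  bound settles the other pairs at the cost of one. Bounds 3 and 5 thus give diameters 4 and
  6.\<close>

lemma near_if_near_point_line:
  assumes pl: "\<And>p l. p \<in> points \<Longrightarrow> l \<in> lines \<Longrightarrow> near n (Inl p) (Inr l)"
    and uv: "u \<in> points <+> lines" "v \<in> points <+> lines"
  shows "near (Suc n) u v"
proof -
  have ex_line: "\<exists>l. (p, l) \<in> inc" if "p \<in> points" for p
    using card_lines_on_point[OF that] by (metis Image_singleton_iff add_gr_0 card.empty ex_in_conv less_irrefl less_one)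
  have ex_point: "\<exists>p. (p, l) \<in> inc" if "l \<in> lines" for l
    using card_points_on_line[OF that] by (metis Image_singleton_iff add_gr_0 card.empty converse_iff ex_in_conv less_irrefl less_one)
  have inc_dest: "p \<in> points" "l \<in> lines" if "(p, l) \<in> inc" for p l
    using that by (auto simp: inc_def)
  show ?thesis
  proof (cases u; cases v)
    fix p p' assume *: "u = Inl p" "v = Inl p'"
    then obtain l where "(p', l) \<in> inc"
      using uv ex_line by auto
    thus ?thesis
      using near_trans[OF pl near_sym[OF near_edge], of p l p'] uv * inc_dest by auto
  next
    fix l l' assume *: "u = Inr l" "v = Inr l'"
    then obtain p where "(p, l') \<in> inc"
      using uv ex_point by auto
    thus ?thesis
      using near_trans[OF near_sym[OF pl] near_edge, of p l l'] uv * inc_dest by auto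
  next
    fix p l assume "u = Inl p" "v = Inr l"
    thus ?thesis
      using uv by (auto intro: near_mono[OF pl])
  next
    fix p l assume "u = Inr l" "v = Inl p"
    thus ?thesis
      using uv by (auto intro: near_mono[OF near_sym[OF pl]])
  qed
qed

text \<open>A functional on a two-dimensional space has a nontrivial kernel. If \<open>f x\<close>
  is nonzero, then so is \<open>f y *s x - f x *s y\<close>, by independence; otherwise
  \<open>x\<close> serves.\<close>

lemma line_meets_kernel:
  fixes f :: "'v \<Rightarrow> 'a"
  assumes "l \<in> lines" and lin: "\<And>a b x y. f (a *s x + b *s y) = a * f x + b * f y"
  obtains w where "w \<in> l" "w \<noteq> 0" "f w = 0"
proof -
  obtain x y where l: "l = join x y" "x \<noteq> 0" "y \<notin> pt x"
    using lineE[OF assms(1)] by metis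
  show ?thesis
  proof (cases "f x = 0")
    case True
    thus ?thesis
      using that[of x] l join_gens by simp
  next
    case False
    have "f y *s x + (- f x) *s y \<noteq> 0"
    proof
      assume "f y *s x + (- f x) *s y = 0"
      hence "f x *s y = f y *s x"
        by simp
      hence "inverse (f x) *s f x *s y = (inverse (f x) * f y) *s x"
        by simp
      thus False
        using l(3) False by (auto simp: pt_def)
    qed
    moreover have "f (f y *s x + (- f x) *s y) = 0"
      by (simp only: lin) simp
    ultimately show ?thesis
      using that l(1) joinI by blast
  qed
qed

section \<open>Lower bounds for distances in the incidence graph\<close>

lemma R_if_relpow_0:
  assumes "(Inl (pt x), Inl (pt y)) \<in> incidence_graph inc ^^ 0" "R x x"
  shows "R x y"
proof -
  have "y \<in> pt x"
    using assms(1) pt_self[of y] by simp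
  thus ?thesis
    using R_lin[OF assms(2,2), of _ 0] by (auto simp: pt_def)
qed

lemma R_if_relpow_2:
  assumes "(Inl (pt x), Inl (pt y)) \<in> incidence_graph inc ^^ 2" "x \<noteq> 0" "y \<noteq> 0"
  shows "R x y"
proof -
  obtain w where w: "(Inl (pt x), w) \<in> incidence_graph inc" "(w, Inl (pt y)) \<in> incidence_graph inc"
    using assms(1) by (auto simp: numeral_2_eq_2)
  then obtain l where "(pt x, l) \<in> inc" "(pt y, l) \<in> inc"
    by (cases w) auto
  thus ?thesis
    using assms(2,3) by (auto simp: inc_pt_iff intro: R_line)
qed

lemma ex_R_if_relpow_4:
  assumes "(Inl (pt x), Inl (pt y)) \<in> incidence_graph inc ^^ 4" "x \<noteq> 0" "y \<noteq> 0"
  shows "\<exists>z. z \<noteq> 0 \<and> R x z \<and> R z y"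
proof -
  have "incidence_graph inc ^^ 4 = incidence_graph inc ^^ 2 O incidence_graph inc ^^ 2"
    by (simp flip: relpow_add)
  then obtain w where w: "(Inl (pt x), w) \<in> incidence_graph inc ^^ 2" "(w, Inl (pt y)) \<in> incidence_graph inc ^^ 2"
    using assms(1) by auto
  obtain p where p: "w = Inl p"
    using incidence_graph_parity[OF w(1)] by (cases w) auto
  have "p \<in> points"
    using w(1) p by (auto simp: numeral_2_eq_2 incidence_graph_def inc_def)
  then obtain z where "p = pt z" "z \<noteq> 0"
    by (auto simp: points_def)
  thus ?thesis
    using w p R_if_relpow_2 assms(2,3) by blast
qed

lemma not_relpow_less_4:
  assumes "x \<noteq> 0" "R x x" "y \<noteq> 0" "\<not> R x y" "n < 4"
  shows "(Inl (pt x), Inl (pt y)) \<notin> incidence_graph inc ^^ n"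
proof
  assume *: "(Inl (pt x), Inl (pt y)) \<in> incidence_graph inc ^^ n"
  hence "even n"
    using incidence_graph_parity[OF *] by simp
  with assms(5) have "n = 0 \<or> n = 2"
    by presburger
  thus False
    using * assms R_if_relpow_0 R_if_relpow_2 by blast
qed

lemma not_relpow_less_6:
  assumes "x \<noteq> 0" "R x x" "y \<noteq> 0" "\<nexists>z. z \<noteq> 0 \<and> R x z \<and> R z y" "n < 6"
  shows "(Inl (pt x), Inl (pt y)) \<notin> incidence_graph inc ^^ n"
proof
  assume *: "(Inl (pt x), Inl (pt y)) \<in> incidence_graph inc ^^ n"
  hence "even n"
    using incidence_graph_parity[OF *] by simp
  with assms(5) have "n < 4 \<or> n = 4"
    by presburger
  \<comment> \<open>Otherwise \<open>z = x\<close> would be a common neighbour, as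
    \<open>R x x\<close> holds.\<close>
  moreover have "\<not> R x y"
    using assms by blast
  ultimately show False
    using * assms not_relpow_less_4 ex_R_if_relpow_4 by blast
qed

lemma ex_bigraph_if_near:
  assumes "d \<ge> 2"
    and "\<And>u v. u \<in> points <+> lines \<Longrightarrow> v \<in> points <+> lines \<Longrightarrow> near d u v"
    and "u \<in> points <+> lines" "v \<in> points <+> lines"
    and "\<And>n. n < d \<Longrightarrow> (u, v) \<notin> incidence_graph inc ^^ n"
  shows "\<exists>G :: (nat, nat \<times> nat) pre_digraph.
    bigraph (CARD('a) + 1) (2 * (CARD('a) + 1)) d G \<and> card (verts G) = 3 * card points"
proof -
  have "\<exists>G :: (nat, nat \<times> nat) pre_digraph.
    bigraph (CARD('a) + 1) (2 * (CARD('a) + 1)) d G \<and> card (verts G) = 2 * card points + card lines"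
  proof (rule ex_bigraph_doubled_points)
    show "inc \<subseteq> points \<times> lines"
      by (auto simp: inc_def)
    show "\<exists>n\<le>d. (u, v) \<in> incidence_graph inc ^^ n" if "u \<in> points <+> lines" "v \<in> points <+> lines" for u v
      using assms(2)[OF that] by (simp add: near_def)
    show "u \<in> points <+> lines" "v \<in> points <+> lines"
      using assms(3,4) .
  qed (use assms(1,5) in \<open>auto simp: card_lines_on_point card_points_on_line\<close>)
  thus ?thesis
    by (simp add: card_lines)
qed

end

section \<open>The projective plane\<close>

definition scale3 :: "'a :: times \<Rightarrow> 'a \<times> 'a \<times> 'a \<Rightarrow> 'a \<times> 'a \<times> 'a" where
  "scale3 c = (\<lambda>(x, y, z). (c * x, c * y, c * z))"

text \<open>The trivial relation makes every vector isotropic and every two-dimensional subspace a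
  line; \<open>card_R\<close> then counts the whole space.\<close>

lemma isotropic_geometry_plane:
  "isotropic_geometry (scale3 :: 'a :: {field, finite} \<Rightarrow> _) (\<lambda>_ _. True)"
  by unfold_locales (auto simp: scale3_def algebra_simps power3_eq_cube)

lemma ex_bigraph_plane:
  "\<exists>G :: (nat, nat \<times> nat) pre_digraph.
     bigraph (CARD('a :: {field, finite}) + 1) (2 * (CARD('a) + 1)) 3 G \<and>
     card (verts G) = 3 * (\<Sum>i<3. CARD('a) ^ i)"
proof -
  interpret isotropic_geometry "scale3 :: 'a \<Rightarrow> _" "\<lambda>_ _. True"
    by (rule isotropic_geometry_plane)
  have meet: "\<exists>x. x \<in> l \<and> x \<in> l' \<and> x \<noteq> 0" if l: "l \<in> lines" "l' \<in> lines" for l l'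
  proof -
    \<comment> \<open>Pigeonhole takes the place of the dimension formula: \<open>q ^ 4\<close>
      pairs have at most \<open>q ^ 3\<close> differences. Two distinct pairs with equal difference
      yield a common nonzero vector.\<close>
    have "\<not> inj_on (\<lambda>(x, y). x - y) (l \<times> l')"
    proof
      assume "inj_on (\<lambda>(x, y). x - y) (l \<times> l')"
      hence "card (l \<times> l') \<le> CARD('a \<times> 'a \<times> 'a)"
        by (intro card_inj_on_le) auto
      hence "CARD('a) ^ 4 \<le> CARD('a) ^ 3"
        by (simp add: card_cartesian_product card_line l power2_eq_square power3_eq_cube power4_eq_xxxx mult.assoc)
      thus False
        using CARD_field_gt_1[where ?'a = 'a] by (simp add: power_increasing_iff)
    qed
    then obtain u v where uv: "u \<in> l \<times> l'" "v \<in> l \<times> l'" "fst u - snd u = fst v - snd v" "u \<noteq> v"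
      unfolding inj_on_def case_prod_unfold by blast
    have eq: "fst u - fst v = snd u - snd v"
      using uv(3) by (simp add: algebra_simps)
    moreover have "fst u - fst v \<in> l" "snd u - snd v \<in> l'"
      using line_closed[of l "fst u" "fst v" 1 "-1"] line_closed[of l' "snd u" "snd v" 1 "-1"] uv l
      by (simp_all add: mem_Times_iff)
    moreover have "fst u - fst v \<noteq> 0"
      using uv(4) eq by (metis eq_iff_diff_eq_0 prod_eqI)
    ultimately show ?thesis
      by metis
  qed
  have points: "near 2 (Inl p) (Inl p')" if "p \<in> points" "p' \<in> points" for p p'
    using that by (auto simp: points_def intro: near_points)
  have point_line: "near 3 (Inl p) (Inr l)" if pl: "p \<in> points" "l \<in> lines" for p l
  proof -
    obtain x where x: "x \<in> l" "x \<noteq> 0"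
      using meet[OF pl(2,2)] by blast
    have "near (2 + 1) (Inl p) (Inr l)"
      using points[OF pl(1) pt_in_points[OF x(2)]] near_line[OF pl(2) x] near_trans by blast
    thus ?thesis by simp
  qed
  have lines: "near 2 (Inr l) (Inr l')" if l: "l \<in> lines" "l' \<in> lines" for l l'
  proof -
    obtain x where "x \<in> l" "x \<in> l'" "x \<noteq> 0"
      using meet[OF l] by blast
    hence "near (1 + 1) (Inr l) (Inr l')"
      using near_trans[OF near_sym[OF near_line] near_line] l by blast
    thus ?thesis by (simp add: numeral_2_eq_2)
  qed
  \<comment> \<open>As the diameter is odd, an extremal pair consists of a point and a line. For a
    non-incident pair, parity leaves only length one to exclude.\<close>
  define p where "p = pt (0, 0, 1 :: 'a)"
  define l where "l = join (1, 0, 0 :: 'a) (0, 1, 0)"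
  have pl: "p \<in> points" "l \<in> lines"
    unfolding p_def l_def
    by (rule pt_in_points; simp add: zero_prod_def)
      (rule join_in_lines; auto simp: zero_prod_def pt_def scale3_def)
  have "(p, l) \<notin> inc"
    unfolding p_def by (subst inc_pt_iff) (auto simp: zero_prod_def l_def join_def scale3_def)
  have "\<exists>G :: (nat, nat \<times> nat) pre_digraph.
    bigraph (CARD('a) + 1) (2 * (CARD('a) + 1)) 3 G \<and> card (verts G) = 3 * card points"
  proof (rule ex_bigraph_if_near)
    fix u v assume "u \<in> points <+> lines" "v \<in> points <+> lines"
    thus "near 3 u v"
      by (elim PlusE) (simp_all add: point_line near_sym[OF point_line] near_mono[OF points] near_mono[OF lines])
  next
    fix n :: nat assume "n < 3"
    thus "(Inl p, Inr l) \<notin> incidence_graph inc ^^ n"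
      using incidence_graph_parity[of "Inl p" "Inr l" n inc] \<open>(p, l) \<notin> inc\<close>
      by (cases "n = 1") (auto, presburger)
  qed (use pl in auto)
  moreover have "card points = (\<Sum>i<3. CARD('a) ^ i)"
    using card_points by (intro eq_geometric_sum CARD_field_gt_1) (simp add: power3_eq_cube)
  ultimately show ?thesis
    by simp
qed

section \<open>The symplectic quadrangle\<close>

definition scale4 :: "'a :: times \<Rightarrow> 'a \<times> 'a \<times> 'a \<times> 'a \<Rightarrow> 'a \<times> 'a \<times> 'a \<times> 'a" where
  "scale4 c = (\<lambda>(x, y, z, w). (c * x, c * y, c * z, c * w))"

definition symplectic :: "'a :: comm_ring \<times> 'a \<times> 'a \<times> 'a \<Rightarrow> 'a \<times> 'a \<times> 'a \<times> 'a \<Rightarrow> 'a" where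
  "symplectic = (\<lambda>(x\<^sub>1, x\<^sub>2, x\<^sub>3, x\<^sub>4) (y\<^sub>1, y\<^sub>2, y\<^sub>3, y\<^sub>4). x\<^sub>1 * y\<^sub>2 - x\<^sub>2 * y\<^sub>1 + x\<^sub>3 * y\<^sub>4 - x\<^sub>4 * y\<^sub>3)"

lemma symplectic_lin:
  "symplectic x (scale4 a y + scale4 b z) = a * symplectic x y + b * symplectic x z"
  by (cases x; cases y; cases z) (simp add: symplectic_def scale4_def algebra_simps)

text \<open>The form is nondegenerate, since pairing with basis vectors recovers every coordinate up
  to sign. So the vectors orthogonal to a nonzero one form a hyperplane.\<close>

lemma isotropic_geometry_symplectic:
  "isotropic_geometry (scale4 :: 'a :: {field, finite} \<Rightarrow> _) (\<lambda>x y. symplectic x y = 0)"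
proof
  fix x :: "'a \<times> 'a \<times> 'a \<times> 'a" assume "x \<noteq> 0"
  then obtain y where "symplectic x y \<noteq> 0"
  proof -
    obtain a b c d where x: "x = (a, b, c, d)"
      by (cases x)
    have "symplectic x (0, 1, 0, 0) = a" "symplectic x (1, 0, 0, 0) = - b"
      "symplectic x (0, 0, 0, 1) = c" "symplectic x (0, 0, 1, 0) = - d"
      by (simp_all add: x symplectic_def)
    thus ?thesis
      using that \<open>x \<noteq> 0\<close> x by (metis neg_equal_0_iff_equal zero_prod_def)
  qed
  hence "CARD('a \<times> 'a \<times> 'a \<times> 'a) = CARD('a) * card {y. symplectic x y = 0}"
    by (intro card_kernel[where scale = scale4 and f = "symplectic x"])
      (auto simp: symplectic_lin, auto simp: scale4_def)
  thus "card {y. symplectic x y = 0} = CARD('a) ^ 3"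
    by (simp add: power3_eq_cube mult.assoc)
next
  show "symplectic x (scale4 a y + scale4 b z) = 0" if "symplectic x y = 0" "symplectic x z = 0"
    for x y z :: "'a \<times> 'a \<times> 'a \<times> 'a" and a b
    using that by (simp add: symplectic_lin)
qed (auto simp: scale4_def symplectic_def zero_prod_def algebra_simps)

lemma ex_bigraph_symplectic:
  "\<exists>G :: (nat, nat \<times> nat) pre_digraph.
     bigraph (CARD('a :: {field, finite}) + 1) (2 * (CARD('a) + 1)) 4 G \<and>
     card (verts G) = 3 * (\<Sum>i<4. CARD('a) ^ i)"
proof -
  interpret isotropic_geometry "scale4 :: 'a \<Rightarrow> _" "\<lambda>x y. symplectic x y = 0"
    by (rule isotropic_geometry_symplectic)
  have null: "symplectic x x = 0" for x :: "'a \<times> 'a \<times> 'a \<times> 'a"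
    by (cases x) (simp add: symplectic_def)
  have point_line: "near 3 (Inl p) (Inr l)" if pl: "p \<in> points" "l \<in> lines" for p l
  proof -
    obtain x where x: "p = pt x" "x \<noteq> 0"
      using pl(1) by (auto simp: points_def)
    \<comment> \<open>The projection of \<open>p\<close> to \<open>l\<close>: \<open>pt w\<close>
      lies on \<open>l\<close> and equals \<open>p\<close> or is collinear with it.\<close>
    obtain w where w: "w \<in> l" "w \<noteq> 0" "symplectic x w = 0"
      using line_meets_kernel[OF pl(2), of "symplectic x"] symplectic_lin by blast
    have "near (2 + 1) (Inl p) (Inr l)"
      unfolding x(1) using near_points[OF x(2) null w(2,3)] near_line[OF pl(2) w(1,2)]
      by (rule near_trans)
    thus ?thesis
      by simp
  qed
  \<comment> \<open>A hyperbolic pair: isotropic vectors that are not orthogonal, hence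
    non-collinear points.\<close>
  define x where "x = (1 :: 'a, 0 :: 'a, 0 :: 'a, 0 :: 'a)"
  define y where "y = (0 :: 'a, 1 :: 'a, 0 :: 'a, 0 :: 'a)"
  have xy: "x \<noteq> 0" "y \<noteq> 0" "symplectic x y \<noteq> 0"
    by (simp_all add: x_def y_def zero_prod_def symplectic_def)
  have "\<exists>G :: (nat, nat \<times> nat) pre_digraph.
    bigraph (CARD('a) + 1) (2 * (CARD('a) + 1)) 4 G \<and> card (verts G) = 3 * card points"
  proof (rule ex_bigraph_if_near)
    show "near 4 u v" if "u \<in> points <+> lines" "v \<in> points <+> lines" for u v
      using near_if_near_point_line[OF point_line that] by simp
    show "Inl (pt x) \<in> points <+> lines" "Inl (pt y) \<in> points <+> lines"
      by (intro InlI pt_in_points xy null)+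
    show "(Inl (pt x), Inl (pt y)) \<notin> incidence_graph inc ^^ n" if "n < 4" for n
      using xy null that by (intro not_relpow_less_4) auto
  qed simp
  moreover have "card points = (\<Sum>i<4. CARD('a) ^ i)"
    using card_points by (intro eq_geometric_sum CARD_field_gt_1) (simp add: null power4_eq_xxxx)
  ultimately show ?thesis
    by simp
qed

section \<open>The split Cayley hexagon\<close>

text \<open>
  The tuple \<open>(v\<^sub>1, w\<^sub>1, v\<^sub>2, w\<^sub>2, v\<^sub>3, w\<^sub>3, a)\<close> stands for the trace-zero split octonion with Zorn vector
  matrix of diagonal \<open>a, - a\<close> and off-diagonal vectors \<open>v, w\<close>. Below, \<open>octonion_product\<close> gives all
  entries of a product but the lower right one, and \<open>octonion_form\<close> is the trace of the product;
  the product is zero iff both vanish.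
\<close>

type_synonym 'a vec7 = "'a \<times> 'a \<times> 'a \<times> 'a \<times> 'a \<times> 'a \<times> 'a"

definition scale7 :: "'a :: times \<Rightarrow> 'a vec7 \<Rightarrow> 'a vec7" where
  "scale7 c = (\<lambda>(v\<^sub>1, w\<^sub>1, v\<^sub>2, w\<^sub>2, v\<^sub>3, w\<^sub>3, a). (c * v\<^sub>1, c * w\<^sub>1, c * v\<^sub>2, c * w\<^sub>2, c * v\<^sub>3, c * w\<^sub>3, c * a))"

definition octonion_product :: "'a :: comm_ring vec7 \<Rightarrow> 'a vec7 \<Rightarrow> 'a vec7" where
  "octonion_product = (\<lambda>(v\<^sub>1, w\<^sub>1, v\<^sub>2, w\<^sub>2, v\<^sub>3, w\<^sub>3, a) (x\<^sub>1, y\<^sub>1, x\<^sub>2, y\<^sub>2, x\<^sub>3, y\<^sub>3, b).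
    (a * x\<^sub>1 - b * v\<^sub>1 - (w\<^sub>2 * y\<^sub>3 - w\<^sub>3 * y\<^sub>2), b * w\<^sub>1 - a * y\<^sub>1 + (v\<^sub>2 * x\<^sub>3 - v\<^sub>3 * x\<^sub>2),
     a * x\<^sub>2 - b * v\<^sub>2 - (w\<^sub>3 * y\<^sub>1 - w\<^sub>1 * y\<^sub>3), b * w\<^sub>2 - a * y\<^sub>2 + (v\<^sub>3 * x\<^sub>1 - v\<^sub>1 * x\<^sub>3),
     a * x\<^sub>3 - b * v\<^sub>3 - (w\<^sub>1 * y\<^sub>2 - w\<^sub>2 * y\<^sub>1), b * w\<^sub>3 - a * y\<^sub>3 + (v\<^sub>1 * x\<^sub>2 - v\<^sub>2 * x\<^sub>1),
     a * b + v\<^sub>1 * y\<^sub>1 + v\<^sub>2 * y\<^sub>2 + v\<^sub>3 * y\<^sub>3))"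

definition octonion_form :: "'a :: comm_ring vec7 \<Rightarrow> 'a vec7 \<Rightarrow> 'a" where
  "octonion_form = (\<lambda>(v\<^sub>1, w\<^sub>1, v\<^sub>2, w\<^sub>2, v\<^sub>3, w\<^sub>3, a) (x\<^sub>1, y\<^sub>1, x\<^sub>2, y\<^sub>2, x\<^sub>3, y\<^sub>3, b).
    a * b + a * b + v\<^sub>1 * y\<^sub>1 + v\<^sub>2 * y\<^sub>2 + v\<^sub>3 * y\<^sub>3 + w\<^sub>1 * x\<^sub>1 + w\<^sub>2 * x\<^sub>2 + w\<^sub>3 * x\<^sub>3)"

definition octonion_annihilates :: "'a :: comm_ring vec7 \<Rightarrow> 'a vec7 \<Rightarrow> bool" where
  "octonion_annihilates x y \<longleftrightarrow> octonion_product x y = 0 \<and> octonion_form x y = 0"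

lemmas octonion_defs = octonion_annihilates_def octonion_product_def octonion_form_def zero_prod_def

text \<open>A trace-zero octonion squares to a scalar, minus its norm. The form at \<open>x\<close>
  is twice this scalar and says nothing in characteristic two; the last entry of the product does.
  The bracketing fits \<open>card_hyperbolic_sum_zeros\<close>.\<close>

lemma octonion_annihilates_self_iff:
  "octonion_annihilates (v\<^sub>1, w\<^sub>1, v\<^sub>2, w\<^sub>2, v\<^sub>3, w\<^sub>3, a) (v\<^sub>1, w\<^sub>1, v\<^sub>2, w\<^sub>2, v\<^sub>3, w\<^sub>3, a) \<longleftrightarrow>
     v\<^sub>1 * w\<^sub>1 + (v\<^sub>2 * w\<^sub>2 + (v\<^sub>3 * w\<^sub>3 + a * a)) = 0"
  for a :: "'a :: field"
proof -
  define x where "x = (v\<^sub>1, w\<^sub>1, v\<^sub>2, w\<^sub>2, v\<^sub>3, w\<^sub>3, a)"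
  define N where "N = v\<^sub>1 * w\<^sub>1 + (v\<^sub>2 * w\<^sub>2 + (v\<^sub>3 * w\<^sub>3 + a * a))"
  have "octonion_product x x = (0, 0, 0, 0, 0, 0, N)" "octonion_form x x = N + N"
    by (simp_all add: x_def N_def octonion_product_def octonion_form_def algebra_simps)
  thus ?thesis
    unfolding x_def[symmetric] N_def[symmetric] by (auto simp: octonion_annihilates_def zero_prod_def)
qed

lemma octonion_form_lin:
  "octonion_form x (scale7 a y + scale7 b z) = a * octonion_form x y + b * octonion_form x z"
  by (cases x; cases y; cases z) (simp add: octonion_form_def scale7_def algebra_simps)

lemma octonion_product_lin:
  "octonion_product x (scale7 a y + scale7 b z) = scale7 a (octonion_product x y) + scale7 b (octonion_product x z)"
  by (cases x; cases y; cases z) (simp add: octonion_product_def scale7_def algebra_simps)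

lemma octonion_annihilates_lin:
  "octonion_annihilates x y \<Longrightarrow> octonion_annihilates x z \<Longrightarrow> octonion_annihilates x (scale7 a y + scale7 b z)"
  for a :: "'a :: comm_ring"
  unfolding octonion_annihilates_def octonion_form_lin octonion_product_lin
  by (simp add: scale7_def zero_prod_def)

text \<open>Conjugation reverses products and negates trace-zero octonions, so it maps
  \<open>x * y\<close> to \<open>y * x\<close>.\<close>

lemma octonion_annihilates_sym:
  fixes x y :: "'a :: field vec7"
  assumes "octonion_annihilates x y"
  shows "octonion_annihilates y x"
proof -
  obtain v\<^sub>1 w\<^sub>1 v\<^sub>2 w\<^sub>2 v\<^sub>3 w\<^sub>3 a where x: "x = (v\<^sub>1, w\<^sub>1, v\<^sub>2, w\<^sub>2, v\<^sub>3, w\<^sub>3, a)"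
    by (cases x)
  obtain x\<^sub>1 y\<^sub>1 x\<^sub>2 y\<^sub>2 x\<^sub>3 y\<^sub>3 b where y: "y = (x\<^sub>1, y\<^sub>1, x\<^sub>2, y\<^sub>2, x\<^sub>3, y\<^sub>3, b)"
    by (cases y)
  show ?thesis
    using assms unfolding x y octonion_defs prod.case prod.inject by (elim conjE; intro conjI; Groebner_Basis.algebra)
qed

text \<open>With \<open>N\<close> the norm form, \<open>N y * x = (x * y) * conj y\<close>; the coordinates of this identity give the claim.\<close>

lemma octonion_annihilates_null:
  fixes x :: "'a :: field vec7"
  assumes "x \<noteq> 0" "octonion_annihilates x y"
  shows "octonion_annihilates y y"
proof -
  obtain v\<^sub>1 w\<^sub>1 v\<^sub>2 w\<^sub>2 v\<^sub>3 w\<^sub>3 a where x: "x = (v\<^sub>1, w\<^sub>1, v\<^sub>2, w\<^sub>2, v\<^sub>3, w\<^sub>3, a)"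
    by (cases x)
  obtain x\<^sub>1 y\<^sub>1 x\<^sub>2 y\<^sub>2 x\<^sub>3 y\<^sub>3 b where y: "y = (x\<^sub>1, y\<^sub>1, x\<^sub>2, y\<^sub>2, x\<^sub>3, y\<^sub>3, b)"
    by (cases y)
  define N where "N = x\<^sub>1 * y\<^sub>1 + (x\<^sub>2 * y\<^sub>2 + (x\<^sub>3 * y\<^sub>3 + b * b))"
  have "N * v\<^sub>1 = 0" "N * v\<^sub>2 = 0" "N * v\<^sub>3 = 0" "N * w\<^sub>1 = 0" "N * w\<^sub>2 = 0" "N * w\<^sub>3 = 0" "N * a = 0"
    using assms(2) unfolding N_def x y octonion_defs by (simp; Groebner_Basis.algebra)+
  hence "N = 0"
    using assms(1) by (auto simp: x zero_prod_def)
  thus ?thesis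
    by (simp only: y octonion_annihilates_self_iff N_def)
qed

text \<open>The split octonions are alternative: \<open>x * (x * y) = x\<^sup>2 * y\<close> and \<open>(x * y) * y = x * y\<^sup>2\<close>.
  Hence orthogonal points of the hexagon have distance at most four.\<close>

lemma octonion_annihilates_product:
  fixes x y :: "'a :: field vec7"
  assumes "octonion_annihilates x x" "octonion_annihilates y y" "octonion_form x y = 0"
  shows "octonion_annihilates x (octonion_product x y)" "octonion_annihilates y (octonion_product x y)"
proof -
  obtain v\<^sub>1 w\<^sub>1 v\<^sub>2 w\<^sub>2 v\<^sub>3 w\<^sub>3 a where x: "x = (v\<^sub>1, w\<^sub>1, v\<^sub>2, w\<^sub>2, v\<^sub>3, w\<^sub>3, a)"
    by (cases x)
  obtain x\<^sub>1 y\<^sub>1 x\<^sub>2 y\<^sub>2 x\<^sub>3 y\<^sub>3 b where y: "y = (x\<^sub>1, y\<^sub>1, x\<^sub>2, y\<^sub>2, x\<^sub>3, y\<^sub>3, b)"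
    by (cases y)
  note assms' = assms[unfolded x y octonion_annihilates_self_iff octonion_form_def prod.case]
  show "octonion_annihilates x (octonion_product x y)" 
    unfolding x y octonion_defs prod.case prod.inject
    using assms' by (intro conjI; Groebner_Basis.algebra)
  show "octonion_annihilates y (octonion_product x y)" 
    unfolding x y octonion_defs prod.case prod.inject
    using assms' by (intro conjI; Groebner_Basis.algebra)
qed

section \<open>Annihilators of null octonions\<close>

lemma card_octonion_annihilates_bij:
  fixes f :: "'a :: comm_ring vec7 \<Rightarrow> 'a vec7"
  assumes "bij f" "\<And>x y. octonion_annihilates (f x) (f y) \<longleftrightarrow> octonion_annihilates x y"
  shows "card {y. octonion_annihilates (f x) y} = card {y. octonion_annihilates x y}"
proof -
  have "y \<in> f ` {y. octonion_annihilates x y}" if "octonion_annihilates (f x) y" for y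
    using that assms(2) surjD[OF bij_is_surj[OF assms(1)], of y] by blast
  hence "{y. octonion_annihilates (f x) y} = f ` {y. octonion_annihilates x y}"
    using assms(2) by blast
  thus ?thesis
    using card_image[OF inj_on_subset[OF bij_is_inj[OF assms(1)] subset_UNIV]] by simp
qed

text \<open>With \<open>v\<^sub>1 = 1\<close> the coordinates \<open>x\<^sub>1\<close>,
  \<open>y\<^sub>2\<close>, \<open>y\<^sub>3\<close> are free: the first entry of the product gives
  \<open>b\<close>, the sixth and fourth give \<open>x\<^sub>2\<close> and \<open>x\<^sub>3\<close>,
  the last gives \<open>y\<^sub>1\<close>. The other equations hold once nullity has eliminated
  \<open>w\<^sub>1\<close>.\<close>

lemma card_octonion_annihilates_1:
  fixes w\<^sub>1 :: "'a :: {field, finite}"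
  assumes "octonion_annihilates (1, w\<^sub>1, v\<^sub>2, w\<^sub>2, v\<^sub>3, w\<^sub>3, a) (1, w\<^sub>1, v\<^sub>2, w\<^sub>2, v\<^sub>3, w\<^sub>3, a)"
  shows "card {y. octonion_annihilates (1, w\<^sub>1, v\<^sub>2, w\<^sub>2, v\<^sub>3, w\<^sub>3, a) y} = CARD('a) ^ 3"
proof -
  define f where "f = (\<lambda>(x\<^sub>1, y\<^sub>2, y\<^sub>3). let b = a * x\<^sub>1 - w\<^sub>2 * y\<^sub>3 + w\<^sub>3 * y\<^sub>2 in
    (x\<^sub>1, - a * b - v\<^sub>2 * y\<^sub>2 - v\<^sub>3 * y\<^sub>3, v\<^sub>2 * x\<^sub>1 + a * y\<^sub>3 - b * w\<^sub>3, y\<^sub>2,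
     v\<^sub>3 * x\<^sub>1 - a * y\<^sub>2 + b * w\<^sub>2, y\<^sub>3, b))"
  define g :: "'a vec7 \<Rightarrow> 'a \<times> 'a \<times> 'a" where "g = (\<lambda>(x\<^sub>1, y\<^sub>1, x\<^sub>2, y\<^sub>2, x\<^sub>3, y\<^sub>3, b). (x\<^sub>1, y\<^sub>2, y\<^sub>3))"
  have w1: "w\<^sub>1 = - (v\<^sub>2 * w\<^sub>2) - v\<^sub>3 * w\<^sub>3 - a * a"
    using assms unfolding octonion_annihilates_self_iff by Groebner_Basis.algebra
  have "bij_betw f UNIV {y. octonion_annihilates (1, w\<^sub>1, v\<^sub>2, w\<^sub>2, v\<^sub>3, w\<^sub>3, a) y}"
  proof (rule bij_betw_byWitness[where f' = g])
    show "\<forall>z\<in>UNIV. g (f z) = z"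
      by (simp add: f_def g_def Let_def split_beta)
    have "f (g y) = y" if "octonion_annihilates (1, w\<^sub>1, v\<^sub>2, w\<^sub>2, v\<^sub>3, w\<^sub>3, a) y" for y
    proof -
      obtain x\<^sub>1 y\<^sub>1 x\<^sub>2 y\<^sub>2 x\<^sub>3 y\<^sub>3 b where y: "y = (x\<^sub>1, y\<^sub>1, x\<^sub>2, y\<^sub>2, x\<^sub>3, y\<^sub>3, b)"
        by (cases y)
      show ?thesis
        using that unfolding y f_def g_def octonion_defs prod.case prod.inject Let_def
        by (elim conjE; intro conjI refl; Groebner_Basis.algebra)
    qed
    thus "\<forall>y\<in>{y. octonion_annihilates (1, w\<^sub>1, v\<^sub>2, w\<^sub>2, v\<^sub>3, w\<^sub>3, a) y}. f (g y) = y"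
      by blast
    have "octonion_annihilates (1, w\<^sub>1, v\<^sub>2, w\<^sub>2, v\<^sub>3, w\<^sub>3, a) (f z)" for z
    proof (cases z)
      case (fields x\<^sub>1 y\<^sub>2 y\<^sub>3)
      show ?thesis
        unfolding fields w1 f_def octonion_defs prod.case prod.inject Let_def
        by (intro conjI; Groebner_Basis.algebra)
    qed
    thus "range f \<subseteq> {y. octonion_annihilates (1, w\<^sub>1, v\<^sub>2, w\<^sub>2, v\<^sub>3, w\<^sub>3, a) y}"
      by blast
  qed simp
  hence "CARD('a \<times> 'a \<times> 'a) = card {y. octonion_annihilates (1, w\<^sub>1, v\<^sub>2, w\<^sub>2, v\<^sub>3, w\<^sub>3, a) y}"
    by (rule bij_betw_same_card)
  thus ?thesis
    by (simp add: power3_eq_cube)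
qed

lemma octonion_annihilates_scale:
  fixes c :: "'a :: field"
  assumes "c \<noteq> 0"
  shows "octonion_annihilates (scale7 c x) y \<longleftrightarrow> octonion_annihilates x y"
proof -
  have scale: "octonion_annihilates (scale7 c x) y" if "octonion_annihilates x y" for c :: 'a and x
  proof -
    have "octonion_annihilates y (scale7 c x + scale7 0 x)"
      using octonion_annihilates_lin octonion_annihilates_sym[OF that] by blast
    moreover have "scale7 c x + scale7 0 x = scale7 c x"
      by (cases x) (simp add: scale7_def)
    ultimately show ?thesis
      by (simp add: octonion_annihilates_sym)
  qed
  moreover have "scale7 (inverse c) (scale7 c x) = x"
    using assms by (cases x) (simp add: scale7_def)
  ultimately show ?thesis
    by metis
qed

text \<open>This map and \<open>octonion_swap\<close> are automorphisms of the split octonions: a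
  cyclic shift of coordinates respects cross products, and the swap exchanges the diagonal entries
  and, up to sign, the off-diagonal vectors. They serve to move a nonzero entry to the first
  coordinate.\<close>

definition octonion_rotate :: "'a vec7 \<Rightarrow> 'a vec7" where
  "octonion_rotate = (\<lambda>(v\<^sub>1, w\<^sub>1, v\<^sub>2, w\<^sub>2, v\<^sub>3, w\<^sub>3, a). (v\<^sub>2, w\<^sub>2, v\<^sub>3, w\<^sub>3, v\<^sub>1, w\<^sub>1, a))"

definition octonion_swap :: "'a :: uminus vec7 \<Rightarrow> 'a vec7" where
  "octonion_swap = (\<lambda>(v\<^sub>1, w\<^sub>1, v\<^sub>2, w\<^sub>2, v\<^sub>3, w\<^sub>3, a). (- w\<^sub>1, - v\<^sub>1, - w\<^sub>2, - v\<^sub>2, - w\<^sub>3, - v\<^sub>3, - a))"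

lemma octonion_annihilates_rotate:
  "octonion_annihilates (octonion_rotate x) (octonion_rotate y) \<longleftrightarrow> octonion_annihilates x y"
  for x y :: "'a :: field vec7"
proof -
  obtain v\<^sub>1 w\<^sub>1 v\<^sub>2 w\<^sub>2 v\<^sub>3 w\<^sub>3 a where x: "x = (v\<^sub>1, w\<^sub>1, v\<^sub>2, w\<^sub>2, v\<^sub>3, w\<^sub>3, a)"
    by (cases x)
  obtain x\<^sub>1 y\<^sub>1 x\<^sub>2 y\<^sub>2 x\<^sub>3 y\<^sub>3 b where y: "y = (x\<^sub>1, y\<^sub>1, x\<^sub>2, y\<^sub>2, x\<^sub>3, y\<^sub>3, b)"
    by (cases y)
  show ?thesis
    unfolding x y octonion_defs octonion_rotate_def prod.case prod.inject
    by (intro iffI; elim conjE; intro conjI; Groebner_Basis.algebra)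
qed

lemma octonion_annihilates_swap:
  "octonion_annihilates (octonion_swap x) (octonion_swap y) \<longleftrightarrow> octonion_annihilates x y"
  for x y :: "'a :: field vec7"
proof -
  obtain v\<^sub>1 w\<^sub>1 v\<^sub>2 w\<^sub>2 v\<^sub>3 w\<^sub>3 a where x: "x = (v\<^sub>1, w\<^sub>1, v\<^sub>2, w\<^sub>2, v\<^sub>3, w\<^sub>3, a)"
    by (cases x)
  obtain x\<^sub>1 y\<^sub>1 x\<^sub>2 y\<^sub>2 x\<^sub>3 y\<^sub>3 b where y: "y = (x\<^sub>1, y\<^sub>1, x\<^sub>2, y\<^sub>2, x\<^sub>3, y\<^sub>3, b)"
    by (cases y)
  show ?thesis
    unfolding x y octonion_defs octonion_swap_def prod.case prod.inject
    by (intro iffI; elim conjE; intro conjI; Groebner_Basis.algebra)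
qed

lemma bij_octonion_rotate: "bij octonion_rotate"
  by (rule o_bij[of "octonion_rotate \<circ> octonion_rotate"]) (auto simp: octonion_rotate_def)

lemma bij_octonion_swap: "bij (octonion_swap :: 'a :: group_add vec7 \<Rightarrow> _)"
  by (rule o_bij[of octonion_swap]) (auto simp: octonion_swap_def)

text \<open>Scaling reduces a nonzero first coordinate to 1, and rotation brings any nonzero
  \<open>v\<close> entry there. If all of these vanish, nullity reads \<open>a * a = 0\<close>, so
  some \<open>w\<close> entry is nonzero and the swap turns it into a \<open>v\<close>
  entry.\<close>

lemma card_octonion_annihilates:
  fixes x :: "'a :: {field, finite} vec7"
  assumes "x \<noteq> 0" "octonion_annihilates x x"
  shows "card {y. octonion_annihilates x y} = CARD('a) ^ 3"
proof -
  have fst: "card {y. octonion_annihilates z y} = CARD('a) ^ 3"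
    if "fst z \<noteq> 0" "octonion_annihilates z z" for z :: "'a vec7"
  proof -
    obtain v\<^sub>1 w\<^sub>1 v\<^sub>2 w\<^sub>2 v\<^sub>3 w\<^sub>3 a where z: "z = (v\<^sub>1, w\<^sub>1, v\<^sub>2, w\<^sub>2, v\<^sub>3, w\<^sub>3, a)"
      by (cases z)
    define z' where "z' = scale7 (inverse v\<^sub>1) z"
    have iff: "octonion_annihilates z' y \<longleftrightarrow> octonion_annihilates z y" for y
      unfolding z'_def using that(1) by (intro octonion_annihilates_scale) (simp add: z)
    hence "octonion_annihilates z' z'"
      using that(2) octonion_annihilates_sym by blast
    moreover have "z' = (1, inverse v\<^sub>1 * w\<^sub>1, inverse v\<^sub>1 * v\<^sub>2, inverse v\<^sub>1 * w\<^sub>2,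
        inverse v\<^sub>1 * v\<^sub>3, inverse v\<^sub>1 * w\<^sub>3, inverse v\<^sub>1 * a)"
      using that(1) by (simp add: z'_def z scale7_def)
    ultimately have "card {y. octonion_annihilates z' y} = CARD('a) ^ 3"
      using card_octonion_annihilates_1 by metis
    thus ?thesis
      by (simp add: iff)
  qed
  note rotate = card_octonion_annihilates_bij[OF bij_octonion_rotate octonion_annihilates_rotate]
  have fst_rotate: "card {y. octonion_annihilates z y} = CARD('a) ^ 3"
    if "octonion_annihilates z z" "fst z \<noteq> 0 \<or> fst (octonion_rotate z) \<noteq> 0 \<or>
      fst (octonion_rotate (octonion_rotate z)) \<noteq> 0" for z :: "'a vec7"
    using that fst[of z] fst[of "octonion_rotate z"] fst[of "octonion_rotate (octonion_rotate z)"]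
    by (auto simp: rotate octonion_annihilates_rotate simp del: split_paired_All)
  obtain v\<^sub>1 w\<^sub>1 v\<^sub>2 w\<^sub>2 v\<^sub>3 w\<^sub>3 a where x: "x = (v\<^sub>1, w\<^sub>1, v\<^sub>2, w\<^sub>2, v\<^sub>3, w\<^sub>3, a)"
    by (cases x)
  show ?thesis
  proof (cases "v\<^sub>1 = 0 \<and> v\<^sub>2 = 0 \<and> v\<^sub>3 = 0")
    case False
    thus ?thesis
      using assms(2) by (intro fst_rotate) (auto simp: x octonion_rotate_def)
  next
    case True
    hence "a * a = 0"
      using assms(2) by (simp add: x octonion_annihilates_self_iff)
    hence "w\<^sub>1 \<noteq> 0 \<or> w\<^sub>2 \<noteq> 0 \<or> w\<^sub>3 \<noteq> 0"
      using True assms(1) by (auto simp: x zero_prod_def)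
    hence "card {y. octonion_annihilates (octonion_swap x) y} = CARD('a) ^ 3"
      using assms(2)
      by (intro fst_rotate)
        (auto simp: x octonion_rotate_def octonion_swap_def
          octonion_annihilates_swap[of x x, unfolded x octonion_swap_def prod.case])
    thus ?thesis
      by (simp only: card_octonion_annihilates_bij[OF bij_octonion_swap octonion_annihilates_swap])
  qed
qed

lemma isotropic_geometry_octonion:
  "isotropic_geometry (scale7 :: 'a :: {field, finite} \<Rightarrow> _) octonion_annihilates"
proof
  show "octonion_annihilates x y \<Longrightarrow> octonion_annihilates y x" for x y :: "'a vec7"
    by (rule octonion_annihilates_sym)
  show "octonion_annihilates x y \<Longrightarrow> octonion_annihilates x z \<Longrightarrow>
      octonion_annihilates x (scale7 a y + scale7 b z)" for x y z :: "'a vec7" and a b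
    by (rule octonion_annihilates_lin)
  show "octonion_annihilates x 0" for x :: "'a vec7"
    by (cases x) (simp add: octonion_defs)
  show "x \<noteq> 0 \<Longrightarrow> octonion_annihilates x y \<Longrightarrow> octonion_annihilates y y" for x y :: "'a vec7"
    by (rule octonion_annihilates_null)
  show "octonion_annihilates x x \<Longrightarrow> x \<noteq> 0 \<Longrightarrow> card {y. octonion_annihilates x y} = CARD('a) ^ 3"
    for x :: "'a vec7"
    by (rule card_octonion_annihilates)
qed (auto simp: scale7_def algebra_simps)

text \<open>The form \<open>a * a\<close> has one zero among \<open>q\<close> arguments; three
  hyperbolic planes are then added, so one \<open>q\<close>-th of the \<open>q ^ 7\<close> vectors
  is null.\<close>

lemma card_octonion_null: "card {x :: 'a :: {field, finite} vec7. octonion_annihilates x x} = CARD('a) ^ 6"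
proof -
  have "{a :: 'a. a * a = 0} = {0}"
    by auto
  hence "CARD('a) * card {a :: 'a. a * a = 0} = CARD('a)"
    by simp
  note card_hyperbolic_sum_zeros[OF this]
  note card_hyperbolic_sum_zeros[OF this[unfolded case_prod_unfold]]
  note card_hyperbolic_sum_zeros[OF this[unfolded case_prod_unfold]]
  moreover have "{x :: 'a vec7. octonion_annihilates x x} =
     {(v\<^sub>1, w\<^sub>1, v\<^sub>2, w\<^sub>2, v\<^sub>3, w\<^sub>3, a). v\<^sub>1 * w\<^sub>1 + (v\<^sub>2 * w\<^sub>2 + (v\<^sub>3 * w\<^sub>3 + a * a)) = 0}"
    by (auto simp: octonion_annihilates_self_iff)
  ultimately show ?thesis
    by (simp add: case_prod_unfold eval_nat_numeral)
qed

lemma ex_bigraph_octonion: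
  "\<exists>G :: (nat, nat \<times> nat) pre_digraph.
     bigraph (CARD('a :: {field, finite}) + 1) (2 * (CARD('a) + 1)) 6 G \<and>
     card (verts G) = 3 * (\<Sum>i<6. CARD('a) ^ i)"
proof -
  interpret isotropic_geometry "scale7 :: 'a \<Rightarrow> _" octonion_annihilates
    by (rule isotropic_geometry_octonion)
  have point_line: "near 5 (Inl p) (Inr l)" if pl: "p \<in> points" "l \<in> lines" for p l
  proof -
    obtain x where x: "p = pt x" "x \<noteq> 0" "octonion_annihilates x x"
      using pl(1) by (auto simp: points_def)
    obtain w where w: "w \<in> l" "w \<noteq> 0" "octonion_form x w = 0"
      using line_meets_kernel[OF pl(2), of "octonion_form x"] octonion_form_lin by blast
    have null_w: "octonion_annihilates w w"
      using R_line[OF pl(2) w(1) w(1)] .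
    have "near 4 (Inl (pt x)) (Inl (pt w))"
    proof (cases "octonion_annihilates x w")
      case True
      thus ?thesis
        using near_mono[OF near_points] x w by simp
    next
      case False
      \<comment> \<open>Since \<open>octonion_form x w = 0\<close>, the product has trace zero and
        this tuple is all of it; it is nonzero because \<open>x\<close> does not annihilate
        \<open>w\<close>.\<close>
      define z where "z = octonion_product x w"
      have z: "z \<noteq> 0" "octonion_annihilates x z" "octonion_annihilates w z"
        using False w(3) octonion_annihilates_product[OF x(3) null_w w(3)]
        by (simp_all add: z_def octonion_annihilates_def)
      have "near (2 + 2) (Inl (pt x)) (Inl (pt w))"
        using near_points[OF x(2,3) z(1,2)] near_points[OF w(2) null_w z(1,3)] near_sym near_trans
        by blast
      thus ?thesis
        by simp
    qed
    from near_trans[OF this near_line[OF pl(2) w(1,2)]] show ?thesis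
      by (simp add: x)
  qed
  \<comment> \<open>Null vectors with \<open>octonion_form x y = 1\<close>; such points are
    opposite.\<close>
  define x where "x = (1 :: 'a, 0 :: 'a, 0 :: 'a, 0 :: 'a, 0 :: 'a, 0 :: 'a, 0 :: 'a)"
  define y where "y = (0 :: 'a, 1 :: 'a, 0 :: 'a, 0 :: 'a, 0 :: 'a, 0 :: 'a, 0 :: 'a)"
  have xy: "x \<noteq> 0" "y \<noteq> 0" "octonion_annihilates x x" "octonion_annihilates y y"
    by (simp_all add: x_def y_def octonion_defs)
  have opposite: "z = 0" if "octonion_annihilates x z" "octonion_annihilates z y" for z
    using that by (cases z) (simp add: x_def y_def octonion_defs)
  have "\<exists>G :: (nat, nat \<times> nat) pre_digraph.
    bigraph (CARD('a) + 1) (2 * (CARD('a) + 1)) 6 G \<and> card (verts G) = 3 * card points"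
  proof (rule ex_bigraph_if_near)
    show "near 6 u v" if "u \<in> points <+> lines" "v \<in> points <+> lines" for u v
      using near_if_near_point_line[OF point_line that] by simp
    show "Inl (pt x) \<in> points <+> lines" "Inl (pt y) \<in> points <+> lines"
      by (intro InlI pt_in_points xy)+
    show "(Inl (pt x), Inl (pt y)) \<notin> incidence_graph inc ^^ n" if "n < 6" for n
      using xy opposite that by (intro not_relpow_less_6) blast+
  qed simp
  moreover have "card points = (\<Sum>i<6. CARD('a) ^ i)"
    using card_points by (intro eq_geometric_sum CARD_field_gt_1) (simp add: card_octonion_null)
  ultimately show ?thesis
    by simp
qed

section \<open>A finite field of the required order\<close>

text \<open>The polynomial \<open>X^q - X\<close> splits over the algebraically closed field. Its
  derivative is the constant -1, since \<open>q\<close> vanishes in the field, so no root is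
  repeated and there are \<open>q\<close> of them.\<close>

lemma card_frobenius_fixed_points:
  assumes prime: "prime CHAR('a :: alg_closed_field)" and q: "q = CHAR('a) ^ n" and n: "n > 0"
  shows "card {x :: 'a. x ^ q = x} = q"
proof -
  define f :: "'a poly" where "f = monom 1 q + monom (-1) 1"
  have q1: "q > 1"
    unfolding q using prime n by (intro one_less_power prime_gt_1_nat)
  have deg: "degree f = q"
    unfolding f_def by (subst degree_add_eq_left) (use q1 in \<open>auto simp: degree_monom_eq\<close>)
  have "lead_coeff f = 1"
    unfolding deg using q1 by (simp add: f_def)
  obtain A where A: "size A = degree f" "f = smult (lead_coeff f) (\<Prod>x\<in>#A. [:-x, 1:])"
    using alg_closed_imp_factorization[of f] deg q1 by force
  hence fA: "f = (\<Prod>x\<in>#A. [:-x, 1:])"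
    by (simp add: \<open>lead_coeff f = 1\<close>)
  have "of_nat q = (0 :: 'a)"
    using n by (simp add: q)
  hence deriv: "pderiv f = -1"
    by (simp add: f_def pderiv_add pderiv_monom monom_0 one_pCons)
  have "count A x = 1" if "x \<in># A" for x
  proof (rule ccontr)
    assume "count A x \<noteq> 1"
    with that have "count A x \<ge> 2"
      using count_greater_zero_iff[of A x] by linarith
    hence "{#x, x#} \<subseteq># A"
      by (simp add: mset_subset_eq_count le_numeral_Suc subseteq_mset_def)
    then obtain B where "A = {#x, x#} + B"
      by (metis subset_mset.le_iff_add)
    hence "f = [:-x, 1:] * ([:-x, 1:] * (\<Prod>x\<in>#B. [:-x, 1:]))"
      by (simp add: fA)
    hence "poly (pderiv f) x = 0"
      by (simp only: pderiv_mult poly_add poly_mult) simp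
    thus False
      by (simp add: deriv)
  qed
  hence "size A = card (set_mset A)"
    by (simp add: size_multiset_overloaded_eq)
  moreover have "set_mset A = {x. poly f x = 0}"
    by (auto simp: fA poly_prod_mset prod_mset_zero_iff)
  ultimately show ?thesis
    using A(1) deg by (simp add: f_def poly_monom)
qed

section \<open>Reduction of all prime powers to one field type\<close>

definition has_bigraphs :: "nat \<Rightarrow> bool" where
  "has_bigraphs q \<longleftrightarrow> (\<forall>d\<in>{3, 4, 6}. \<exists>G :: (nat, nat \<times> nat) pre_digraph.
     bigraph (q + 1) (2 * (q + 1)) d G \<and> card (verts G) = 3 * (\<Sum>i<d. q ^ i))"

text \<open>
  The geometries are built over field types, whereas a type cannot depend on the variable \<open>q\<close>.
  The closed term \<open>exceptional_order\<close> is a counterexample to \<open>has_bigraphs\<close> if there is one, so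
  that one field type of this order suffices for all prime powers.
\<close>

definition exceptional_order :: nat where
  "exceptional_order = (SOME q. primepow q \<and> ((\<exists>q. primepow q \<and> \<not> has_bigraphs q) \<longrightarrow> \<not> has_bigraphs q))"

lemma exceptional_order:
  shows primepow_exceptional_order: "primepow exceptional_order"
    and has_bigraphs_if_exceptional_order: "has_bigraphs exceptional_order \<Longrightarrow> primepow q \<Longrightarrow> has_bigraphs q"
proof -
  \<comment> \<open>The drinker principle: if there is no counterexample, any prime power will do,
    here 2.\<close>
  have "\<exists>q. primepow q \<and> ((\<exists>q. primepow q \<and> \<not> has_bigraphs q) \<longrightarrow> \<not> has_bigraphs q)"
    using primepow_prime[OF two_is_prime_nat] by metis
  from someI_ex[OF this] show "primepow exceptional_order"
    "has_bigraphs exceptional_order \<Longrightarrow> primepow q \<Longrightarrow> has_bigraphs q"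
    unfolding exceptional_order_def by blast+
qed

lemma prime_aprimedivisor_exceptional_order: "prime (aprimedivisor exceptional_order)"
  using primepow_gt_Suc_0[OF primepow_exceptional_order] by (intro aprimedivisor_nat) simp

text \<open>\<open>mod_ring\<close> takes its modulus from the cardinality of an index type, so the
  prime below \<open>exceptional_order\<close> has to become a type first.\<close>

typedef exceptional_residue = "{..<aprimedivisor exceptional_order}"
  using prime_gt_0_nat[OF prime_aprimedivisor_exceptional_order] by blast

lemma CARD_exceptional_residue: "CARD(exceptional_residue) = aprimedivisor exceptional_order"
  using type_definition.card[OF type_definition_exceptional_residue] by simp

instance exceptional_residue :: prime_card
  by standard (simp add: CARD_exceptional_residue prime_aprimedivisor_exceptional_order)

type_synonym exceptional_closure = "exceptional_residue mod_ring alg_closure"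

lemma exceptional_CHAR:
  "prime CHAR(exceptional_closure)"
  "exceptional_order = CHAR(exceptional_closure) ^ multiplicity (aprimedivisor exceptional_order) exceptional_order"
  "multiplicity (aprimedivisor exceptional_order) exceptional_order > 0"
proof -
  show "prime CHAR(exceptional_closure)"
    by (simp add: CARD_exceptional_residue prime_aprimedivisor_exceptional_order)
  show "exceptional_order = CHAR(exceptional_closure) ^ multiplicity (aprimedivisor exceptional_order) exceptional_order"
    by (simp add: CARD_exceptional_residue primepow_decompose primepow_exceptional_order)
  show "multiplicity (aprimedivisor exceptional_order) exceptional_order > 0"
    by (simp add: primepow_gt_Suc_0[OF primepow_exceptional_order])
qed

lemma exceptional_frobenius_add:
  "(x + y :: exceptional_closure) ^ exceptional_order = x ^ exceptional_order + y ^ exceptional_order"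
  using exceptional_CHAR by (intro freshmans_dream')

text \<open>Additivity at \<open>x + (- x) = 0\<close> avoids distinguishing even from odd
  exponents.\<close>

lemma exceptional_frobenius_minus:
  "(- x :: exceptional_closure) ^ exceptional_order = - (x ^ exceptional_order)"
proof -
  have "x ^ exceptional_order + (- x) ^ exceptional_order = 0 ^ exceptional_order"
    by (simp flip: exceptional_frobenius_add)
  thus ?thesis
    using primepow_gt_0_nat[OF primepow_exceptional_order] 
    by (simp add: eq_neg_iff_add_eq_0 add.commute)
qed

text \<open>The fixed points of a power of the Frobenius endomorphism form a subfield of the
  closure; this is the field of order \<open>exceptional_order\<close>.\<close>

typedef exceptional_field = "{x :: exceptional_closure. x ^ exceptional_order = x}"
  using power_one by blast

lemma CARD_exceptional_field: "CARD(exceptional_field) = exceptional_order"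
  using type_definition.card[OF type_definition_exceptional_field]
    card_frobenius_fixed_points[OF exceptional_CHAR] by simp

setup_lifting type_definition_exceptional_field

instantiation exceptional_field :: field
begin

lift_definition zero_exceptional_field :: exceptional_field is 0
  using primepow_gt_0_nat[OF primepow_exceptional_order] by simp
lift_definition one_exceptional_field :: exceptional_field is 1
  by simp
lift_definition plus_exceptional_field :: "exceptional_field \<Rightarrow> exceptional_field \<Rightarrow> exceptional_field" is "(+)"
  by (simp add: exceptional_frobenius_add)
lift_definition uminus_exceptional_field :: "exceptional_field \<Rightarrow> exceptional_field" is uminus
  by (simp add: exceptional_frobenius_minus)
lift_definition minus_exceptional_field :: "exceptional_field \<Rightarrow> exceptional_field \<Rightarrow> exceptional_field" is "(-)"
  by (simp add: exceptional_frobenius_add exceptional_frobenius_minus diff_conv_add_uminus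
        del: add_uminus_conv_diff)
lift_definition times_exceptional_field :: "exceptional_field \<Rightarrow> exceptional_field \<Rightarrow> exceptional_field" is "(*)"
  by (simp add: power_mult_distrib)
lift_definition inverse_exceptional_field :: "exceptional_field \<Rightarrow> exceptional_field" is inverse
  by (simp add: power_inverse)
lift_definition divide_exceptional_field :: "exceptional_field \<Rightarrow> exceptional_field \<Rightarrow> exceptional_field" is "(/)"
  by (simp add: power_divide)

instance
  by standard (transfer; simp add: field_simps)+

end

instance exceptional_field :: finite
proof
  have "CARD(exceptional_field) > 0"
    using primepow_gt_0_nat[OF primepow_exceptional_order] by (simp add: CARD_exceptional_field)
  thus "finite (UNIV :: exceptional_field set)"
    by (rule card_ge_0_finite)
qed

lemma ex_bigraph_if_primepow:
  assumes "primepow q" "d \<in> {3, 4, 6}"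
  shows "\<exists>G :: (nat, nat \<times> nat) pre_digraph.
    bigraph (q + 1) (2 * (q + 1)) d G \<and> card (verts G) = 3 * (\<Sum>i<d. q ^ i)"
proof -
  have "has_bigraphs CARD(exceptional_field)"
    unfolding has_bigraphs_def
    using ex_bigraph_plane[where ?'a = exceptional_field]
      ex_bigraph_symplectic[where ?'a = exceptional_field]
      ex_bigraph_octonion[where ?'a = exceptional_field] by simp
  hence "has_bigraphs q"
    using has_bigraphs_if_exceptional_order assms(1) by (simp add: CARD_exceptional_field)
  thus ?thesis
    using assms(2) unfolding has_bigraphs_def by blast
qed

section \<open>Moore bounds and defects\<close>

lemma moore_bound_3:
  "moore_bound r 3 = (if odd r then 3 / 2 * (1 + real r * (2 * real r - 1)) else 3 / 2 * (real r * (2 * real r - 1)))"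
proof (cases "odd r")
  case True
  then obtain k where k: "r = 2 * k + 1"
    by (elim oddE)
  \<comment> \<open>\<open>r * (2 * r - 1)\<close> has the parity of \<open>r\<close>: for odd
    \<open>r\<close> the quotient is already an integer, for even \<open>r\<close> the floor removes
    one half.\<close>
  have "(1 + real r * (2 * real r - 1)) / 2 = of_int (4 * int k ^ 2 + 3 * int k + 1)"
    by (simp add: k field_simps power2_eq_square)
  hence "\<lfloor>(1 + real r * (2 * real r - 1)) / 2\<rfloor> = 4 * int k ^ 2 + 3 * int k + 1"
    by (simp only: floor_of_int)
  hence "moore_bound r 3 = 3 * real_of_int (4 * int k ^ 2 + 3 * int k + 1)"
    unfolding moore_bound_def by simp
  thus ?thesis
    by (simp add: k field_simps power2_eq_square)
next
  case False
  then obtain k where k: "r = 2 * k"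
    by (auto elim: evenE)
  have "\<lfloor>(1 + real r * (2 * real r - 1)) / 2\<rfloor> = 4 * int k ^ 2 - int k"
    by (rule floor_unique) (simp_all add: k field_simps power2_eq_square)
  hence "moore_bound r 3 = 3 * real_of_int (4 * int k ^ 2 - int k)"
    unfolding moore_bound_def by simp
  thus ?thesis
    by (simp add: k field_simps power2_eq_square)
qed

text \<open>The bound is a geometric sum written as a quotient by \<open>t - 1\<close>. From
  \<open>r \<ge> 3\<close> follows \<open>t \<ge> 4\<close>, so the denominator is nonzero and
  cancels.\<close>

lemma moore_bound_even:
  assumes "r \<ge> 3"
  defines "t \<equiv> (2 * real r - 1) * (real r - 1)"
  shows "moore_bound r 4 = 3 * real r * (t + 1)" "moore_bound r 6 = 3 * real r * (t ^ 2 + t + 1)"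
proof -
  have "2 * 2 \<le> (2 * real r - 1) * (real r - 1)"
    using assms(1) by (intro mult_mono) auto
  hence "t - 1 \<noteq> 0"
    by (simp add: t_def)
  moreover have "t ^ 2 - 1 = (t + 1) * (t - 1)" "t ^ 3 - 1 = (t ^ 2 + t + 1) * (t - 1)"
    by (simp_all add: algebra_simps power2_eq_square power3_eq_cube)
  ultimately have "(t ^ 2 - 1) / (t - 1) = t + 1" "(t ^ 3 - 1) / (t - 1) = t ^ 2 + t + 1"
    by simp_all
  thus "moore_bound r 4 = 3 * real r * (t + 1)" "moore_bound r 6 = 3 * real r * (t ^ 2 + t + 1)"
    by (simp_all add: moore_bound_def t_def)
qed

theorem theorem4p5:
  fixes r :: nat
  assumes "r \<ge> 3" and "primepow (r - 1)"
  shows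
    "(\<exists>G :: (nat, nat \<times> nat) pre_digraph. bigraph r (2 * r) 3 G \<and>
        real (card (verts G)) = 3 * real r ^ 2 - 3 * real r + 3 \<and>
        (odd r \<longrightarrow> defect r 3 G = 3 / 2 * (real r - 1)) \<and>
        (even r \<longrightarrow> defect r 3 G = 3 * real r / 2 - 3)) \<and>
     (\<exists>G :: (nat, nat \<times> nat) pre_digraph. bigraph r (2 * r) 4 G \<and>
        real (card (verts G)) = 3 * real r ^ 3 - 6 * real r ^ 2 + 6 * real r \<and>
        defect r 4 G = 3 * real r ^ 3 - 3 * real r ^ 2) \<and>
     (\<exists>G :: (nat, nat \<times> nat) pre_digraph. bigraph r (2 * r) 6 G \<and>
        real (card (verts G)) =
          3 * real r ^ 5 - 12 * real r ^ 4 + 21 * real r ^ 3 - 18 * real r ^ 2 + 9 * real r \<and>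
        defect r 6 G =
          9 * real r ^ 5 - 24 * real r ^ 4 + 24 * real r ^ 3 - 9 * real r ^ 2)"
proof -
  define q where "q = r - 1"
  have r: "q + 1 = r"
    using assms(1) by (simp add: q_def)
  obtain G\<^sub>3 G\<^sub>4 G\<^sub>6 :: "(nat, nat \<times> nat) pre_digraph" where
    big: "bigraph r (2 * r) 3 G\<^sub>3" "bigraph r (2 * r) 4 G\<^sub>4" "bigraph r (2 * r) 6 G\<^sub>6" and
    card: "card (verts G\<^sub>3) = 3 * (\<Sum>i<3. q ^ i)" "card (verts G\<^sub>4) = 3 * (\<Sum>i<4. q ^ i)"
      "card (verts G\<^sub>6) = 3 * (\<Sum>i<6. q ^ i)"
    using assms(2) ex_bigraph_if_primepow[of q 3] ex_bigraph_if_primepow[of q 4]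
      ex_bigraph_if_primepow[of q 6] unfolding r by (auto simp: q_def)
  have sums: "(\<Sum>i<3. q ^ i) = 1 + q + q ^ 2" "(\<Sum>i<4. q ^ i) = 1 + q + q ^ 2 + q ^ 3"
    "(\<Sum>i<6. q ^ i) = 1 + q + q ^ 2 + q ^ 3 + q ^ 4 + q ^ 5"
    by (simp_all add: eval_nat_numeral)
  \<comment> \<open>Writing \<open>r\<close> as \<open>q + 1\<close> turns the orders into
    polynomial identities over the reals, free of the truncated \<open>r - 1\<close>.\<close>
  have real_r: "real r = real q + 1"
    using r by auto
  have order: "real (card (verts G\<^sub>3)) = 3 * real r ^ 2 - 3 * real r + 3"
    "real (card (verts G\<^sub>4)) = 3 * real r ^ 3 - 6 * real r ^ 2 + 6 * real r"
    "real (card (verts G\<^sub>6)) =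
      3 * real r ^ 5 - 12 * real r ^ 4 + 21 * real r ^ 3 - 18 * real r ^ 2 + 9 * real r"
    unfolding card sums real_r of_nat_mult of_nat_add of_nat_power of_nat_numeral of_nat_1
    by Groebner_Basis.algebra+
  have "odd r \<longrightarrow> defect r 3 G\<^sub>3 = 3 / 2 * (real r - 1)"
    "even r \<longrightarrow> defect r 3 G\<^sub>3 = 3 * real r / 2 - 3"
    unfolding defect_def order moore_bound_3 by (simp_all add: field_simps power2_eq_square)
  moreover have "defect r 4 G\<^sub>4 = 3 * real r ^ 3 - 3 * real r ^ 2"
    "defect r 6 G\<^sub>6 = 9 * real r ^ 5 - 24 * real r ^ 4 + 24 * real r ^ 3 - 9 * real r ^ 2"
    unfolding defect_def order moore_bound_even[OF assms(1)] by Groebner_Basis.algebra+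
  ultimately show ?thesis
    using big order by blast
qed

end
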